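(* Let $\mathscr T=(V,\mathcal E)$ be the directed Cartesian product of locally finite rooted directed trees $\mathscr T_1,\dots,\mathscr T_d$ of finite joint branching index, let $a>0$, and let $S_{\boldsymbol\lambda_{\mathfrak C_a}}=(S_1,\dots,S_d)$ be the multishift on $\mathscr T$ with weights $$\lambda^{(j)}_w=\frac{1}{\sqrt{\mathrm{card}(\mathsf{Chi}_j(v))}}\sqrt{\frac{\alpha_{v_j}+1}{|\alpha_v|+a}}\qquad (w\in\mathsf{Chi}_j(v),\ v\in V,\ j=1,\dots,d).$$ Let $E$ be the joint kernel $\bigcap_j\ker S_j^*$. Then $S_{\boldsymbol\lambda_{\mathfrak C_a}}$ is unitarily equivalent to the $d$-tuple $\mathscr M_{z,a}=(\mathscr M_{z_1},\dots,\mathscr M_{z_d})$ of multiplication by the coordinate functions on a reproducing kernel Hilbert space $\mathscr H_{a,d}$ of $E$-valued holomorphic functions on the open unit ball $\mathbb B^d\subseteq\mathbb C^d$, and the reproducing kernel $\kappa:\mathbb B^d\times\mathbb B^d\to B(E)$ of $\mathscr H_{a,d}$ is $$\kappa(z,w)=\sum_{\alpha\in\mathbb N^d}\frac{a(a+1)\cdots(a+|\alpha|-1)}{\alpha!}z^\alpha\overline w^\alpha\,P_{[e_{\mathsf{root}}]}+\sum_{\emptyset\ne F\subseteq\{1,\dots,d\}}\ \sum_{u\in\Omega_F}\kappa_{u,F}(z,w),$$ where $$\kappa_{u,F}(z,w)=\sum_{\alpha\in\mathbb N^d}\frac{\alpha_u!}{(\alpha_u+\alpha)!}\Big(\prod_{j=0}^{|\alpha|-1}(|\alpha_u|+a+j)\Big)z^\alpha\overline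 w^\alpha\,P_{\mathcal L_{u,F}},$$ and $P_{\mathcal M}$ denotes the orthogonal projection of $E$ onto a subspace $\mathcal M$.
   Context: A directed tree is a directed graph $(V,\mathcal E)$ (no loops) with no circuits, connected (ignoring orientation), in which each vertex with an incoming edge has exactly one parent $\mathsf{par}(v)$; rooted means there is a (unique) vertex $\mathsf{root}$ without parent. $\mathsf{Chi}(u)=\{v:(u,v)\in\mathcal E\}$; locally finite means each $\mathsf{Chi}(u)$ finite; all trees are assumed leafless ($\mathsf{Chi}(u)\neq\emptyset$). The depth of $u$ is the $n$ with $u\in\mathsf{Chi}^n(\mathsf{root})$. Branching index of a rooted tree: $k=1+\sup\{\text{depth}(w): \mathrm{card}\,\mathsf{Chi}(w)\ge2\}$ if such $w$ exist, else $0$; finite joint branching index means each $\mathscr T_j$ has finite branching index. Directed Cartesian product of rooted trees $\mathscr T_j=(V_j,\mathcal E_j)$ (roots $\mathsf{root}_j$): $V=V_1\times\dots\times V_d$ (countably infinite), $(v,w)\in\mathcal E$ iff for some $k$, $(v_k,w_k)\in\mathcal E_k$ and $w_j=v_j$ for $j\ne k$; $\mathsf{root}=(\mathsf{root}_1,\dots,\mathsf{root}_d)$. $\mathsf{Chi}_j(v)=\{w:w_j\in\mathsf{Chi}(v_j),w_k=v_k\ (k\ne j)\}$; for $v_j\neq\mathsf{root}_j$, $\mathsf{par}_j(v)$ replaces $v_j$ by $\mathsf{par}(v_j)$. Depth $\alpha_v=(\alpha_{v_1},\dots,\alpha_{v_d})\in\mathbb N^d$ with $\alpha_{v_j}$ the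 depth of $v_j$ in $\mathscr T_j$; $|\alpha|=\sum\alpha_j$, $\alpha!=\prod\alpha_j!$. The multishift with positive weights $\lambda^{(j)}_v$ ($v\ne\mathsf{root}$) is $S_je_v=\sum_{w\in\mathsf{Chi}_j(v)}\lambda^{(j)}_we_w$ on $l^2(V)$ (orthonormal basis $\{e_v\}$). Siblings: for $v_j\neq\mathsf{root}_j$, $\mathsf{sib}_j(v)=\mathsf{Chi}_j(\mathsf{par}_j(v))$, and $\mathsf{sib}_j(W)=\bigcup_{u\in W}\mathsf{sib}_j(u)$. For $F=\{i_1,\dots,i_k\}\subseteq\{1,\dots,d\}$ let $\Phi_F=\{v\in V: v_j\ne\mathsf{root}_j\text{ iff }j\in F\}$ and for $u\in\Phi_F$, $\mathsf{sib}_F(u)=\mathsf{sib}_{i_1}\cdots\mathsf{sib}_{i_k}(u)$. The sets $\mathsf{sib}_F(u)$, $u\in\Phi_F$, partition $\Phi_F$; $\Omega_F$ is a set containing exactly one element of each of them. For $u\in\Omega_F$, $\mathcal L_{u,F}$ is the set of $f\in l^2(\mathsf{sib}_F(u))$ such that $\sum_{w\in\mathsf{sib}_i(v)}f(w)\lambda^{(i)}_w=0$ for all $i\in F$ and all $v\in\mathsf{sib}_F(u)$; these are subspaces of $E$. $[e_{\mathsf{root}}]$ is the span of $e_{\mathsf{root}}$. *)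

theory Defs
  imports "HOL-Analysis.Analysis"
begin

section \<open>Directed trees\<close>

definition directed_tree :: "'a set \<Rightarrow> ('a \<times> 'a) set \<Rightarrow> bool" where
  "directed_tree V E \<longleftrightarrow>
     E \<subseteq> V \<times> V \<and>
     (\<forall>v. (v, v) \<notin> E) \<and>
     (\<forall>v. (v, v) \<notin> E\<^sup>+) \<and>
     (\<forall>u\<in>V. \<forall>v\<in>V. (u, v) \<in> (E \<union> E\<inverse>)\<^sup>*) \<and>
     (\<forall>v\<in>V. (\<exists>u. (u, v) \<in> E) \<longrightarrow> (\<exists>!u. (u, v) \<in> E))"

definition rooted_tree :: "'a set \<Rightarrow> ('a \<times> 'a) set \<Rightarrow> 'a \<Rightarrow> bool" where
  "rooted_tree V E r \<longleftrightarrow> directed_tree V E \<and> r \<in> V \<and>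
     (\<forall>u. (u, r) \<notin> E) \<and> (\<forall>v\<in>V. v \<noteq> r \<longrightarrow> (\<exists>u. (u, v) \<in> E))"

definition children :: "('a \<times> 'a) set \<Rightarrow> 'a \<Rightarrow> 'a set" where
  "children E u = {v. (u, v) \<in> E}"

definition parent :: "('a \<times> 'a) set \<Rightarrow> 'a \<Rightarrow> 'a" where
  "parent E v = (THE u. (u, v) \<in> E)"

definition locally_finite :: "'a set \<Rightarrow> ('a \<times> 'a) set \<Rightarrow> bool" where
  "locally_finite V E \<longleftrightarrow> (\<forall>u\<in>V. finite (children E u))"

definition leafless :: "'a set \<Rightarrow> ('a \<times> 'a) set \<Rightarrow> bool" where
  "leafless V E \<longleftrightarrow> (\<forall>u\<in>V. children E u \<noteq> {})"

text \<open>depth of u: the n with u in Chi^n(root)\<close>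
definition depth :: "('a \<times> 'a) set \<Rightarrow> 'a \<Rightarrow> 'a \<Rightarrow> nat" where
  "depth E r u = (THE n. (r, u) \<in> E ^^ n)"

text \<open>finite branching index: the set of depths of branching vertices has a finite supremum\<close>
definition finite_branching_index :: "'a set \<Rightarrow> ('a \<times> 'a) set \<Rightarrow> 'a \<Rightarrow> bool" where
  "finite_branching_index V E r \<longleftrightarrow>
     finite {depth E r w | w. w \<in> V \<and> card (children E w) \<ge> 2}"

section \<open>Directed Cartesian product (trees indexed by the finite type 'd)\<close>

definition prodV :: "('d \<Rightarrow> 'a set) \<Rightarrow> ('d \<Rightarrow> 'a) set" where
  "prodV Vt = {v. \<forall>j. v j \<in> Vt j}"

definition chi_j :: "('d \<Rightarrow> ('a \<times> 'a) set) \<Rightarrow> 'd \<Rightarrow> ('d \<Rightarrow> 'a) \<Rightarrow> ('d \<Rightarrow> 'a) set" where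
  "chi_j Et j v = {w. w j \<in> children (Et j) (v j) \<and> (\<forall>k. k \<noteq> j \<longrightarrow> w k = v k)}"

definition par_j :: "('d \<Rightarrow> ('a \<times> 'a) set) \<Rightarrow> 'd \<Rightarrow> ('d \<Rightarrow> 'a) \<Rightarrow> ('d \<Rightarrow> 'a)" where
  "par_j Et j v = v(j := parent (Et j) (v j))"

definition alpha :: "('d \<Rightarrow> ('a \<times> 'a) set) \<Rightarrow> ('d \<Rightarrow> 'a) \<Rightarrow> ('d \<Rightarrow> 'a) \<Rightarrow> 'd \<Rightarrow> nat" where
  "alpha Et rt v = (\<lambda>j. depth (Et j) (rt j) (v j))"

text \<open>weights lambda^(j)_w (for w in Chi_j(v), i.e. v = par_j w)\<close>
definition weight :: "('d::finite \<Rightarrow> ('a \<times> 'a) set) \<Rightarrow> ('d \<Rightarrow> 'a) \<Rightarrow> real \<Rightarrow> 'd \<Rightarrow> ('d \<Rightarrow> 'a) \<Rightarrow> real" where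
  "weight Et rt a j w =
     (let v = par_j Et j w in
       1 / sqrt (real (card (chi_j Et j v))) *
       sqrt ((real (alpha Et rt v j) + 1) / (real (\<Sum>k\<in>UNIV. alpha Et rt v k) + a)))"

section \<open>The Hilbert space l^2(V)\<close>

definition l2 :: "'v set \<Rightarrow> ('v \<Rightarrow> complex) set" where
  "l2 V = {f. (\<forall>x. x \<notin> V \<longrightarrow> f x = 0) \<and> (\<lambda>x. (cmod (f x))\<^sup>2) summable_on V}"

definition l2_inner :: "'v set \<Rightarrow> ('v \<Rightarrow> complex) \<Rightarrow> ('v \<Rightarrow> complex) \<Rightarrow> complex" where
  "l2_inner V f g = infsum (\<lambda>x. f x * cnj (g x)) V"

text \<open>orthogonal projection onto a (closed) subspace M of l^2(V)\<close>
definition orth_proj :: "'v set \<Rightarrow> ('v \<Rightarrow> complex) set \<Rightarrow> ('v \<Rightarrow> complex) \<Rightarrow> ('v \<Rightarrow> complex)" where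
  "orth_proj V M e = (THE p. p \<in> M \<and> (\<forall>m\<in>M. l2_inner V (\<lambda>x. e x - p x) m = 0))"

text \<open>the multishift S_j: (S_j f)(w) = lambda^(j)_w f(par_j w) if w_j is not the root, else 0;
  on basis vectors this is S_j e_v = sum over w in Chi_j(v) of lambda^(j)_w e_w\<close>
definition shift :: "('d::finite \<Rightarrow> 'a set) \<Rightarrow> ('d \<Rightarrow> ('a \<times> 'a) set) \<Rightarrow> ('d \<Rightarrow> 'a) \<Rightarrow> real \<Rightarrow> 'd
                      \<Rightarrow> (('d \<Rightarrow> 'a) \<Rightarrow> complex) \<Rightarrow> (('d \<Rightarrow> 'a) \<Rightarrow> complex)" where
  "shift Vt Et rt a j f = (\<lambda>w. if w \<in> prodV Vt \<and> w j \<noteq> rt j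
       then complex_of_real (weight Et rt a j w) * f (par_j Et j w) else 0)"

text \<open>joint kernel E = intersection of ker S_j^* = intersection of (ran S_j)^perp\<close>
definition jointKer :: "('d::finite \<Rightarrow> 'a set) \<Rightarrow> ('d \<Rightarrow> ('a \<times> 'a) set) \<Rightarrow> ('d \<Rightarrow> 'a) \<Rightarrow> real
                         \<Rightarrow> (('d \<Rightarrow> 'a) \<Rightarrow> complex) set" where
  "jointKer Vt Et rt a = {f \<in> l2 (prodV Vt).
      \<forall>j. \<forall>g\<in>l2 (prodV Vt). l2_inner (prodV Vt) (shift Vt Et rt a j g) f = 0}"

text \<open>[e_root]\<close>
definition root_line :: "('d \<Rightarrow> 'a) \<Rightarrow> (('d \<Rightarrow> 'a) \<Rightarrow> complex) set" where
  "root_line rt = {(\<lambda>x. if x = rt then c else 0) | c. True}"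

section \<open>Siblings, Phi_F, L_{u,F}\<close>

definition PhiF :: "('d \<Rightarrow> 'a set) \<Rightarrow> ('d \<Rightarrow> 'a) \<Rightarrow> 'd set \<Rightarrow> ('d \<Rightarrow> 'a) set" where
  "PhiF Vt rt F = {v \<in> prodV Vt. \<forall>j. v j \<noteq> rt j \<longleftrightarrow> j \<in> F}"

text \<open>sib_j(v) = Chi_j(par_j(v))\<close>
definition sib_j :: "('d \<Rightarrow> ('a \<times> 'a) set) \<Rightarrow> 'd \<Rightarrow> ('d \<Rightarrow> 'a) \<Rightarrow> ('d \<Rightarrow> 'a) set" where
  "sib_j Et j v = chi_j Et j (par_j Et j v)"

text \<open>sib_F(u) = sib_{i1} ... sib_{ik}(u), written out coordinatewise\<close>
definition sibF :: "('d \<Rightarrow> ('a \<times> 'a) set) \<Rightarrow> 'd set \<Rightarrow> ('d \<Rightarrow> 'a) \<Rightarrow> ('d \<Rightarrow> 'a) set" where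
  "sibF Et F u = {w. \<forall>j. if j \<in> F then w j \<in> children (Et j) (parent (Et j) (u j)) else w j = u j}"

definition LuF :: "('d::finite \<Rightarrow> 'a set) \<Rightarrow> ('d \<Rightarrow> ('a \<times> 'a) set) \<Rightarrow> ('d \<Rightarrow> 'a) \<Rightarrow> real
                   \<Rightarrow> 'd set \<Rightarrow> ('d \<Rightarrow> 'a) \<Rightarrow> (('d \<Rightarrow> 'a) \<Rightarrow> complex) set" where
  "LuF Vt Et rt a F u = {f \<in> l2 (prodV Vt). (\<forall>x. x \<notin> sibF Et F u \<longrightarrow> f x = 0) \<and>
      (\<forall>i\<in>F. \<forall>v\<in>sibF Et F u.
          (\<Sum>w\<in>sib_j Et i v. f w * complex_of_real (weight Et rt a i w)) = 0)}"

section \<open>Multi-indices, the kernel\<close>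

definition mpow :: "complex ^ 'd \<Rightarrow> ('d::finite \<Rightarrow> nat) \<Rightarrow> complex" where
  "mpow z \<alpha> = (\<Prod>j\<in>UNIV. (z $ j) ^ (\<alpha> j))"

definition mfact :: "('d::finite \<Rightarrow> nat) \<Rightarrow> real" where
  "mfact \<alpha> = (\<Prod>j\<in>UNIV. fact (\<alpha> j))"

definition mabs :: "('d::finite \<Rightarrow> nat) \<Rightarrow> nat" where
  "mabs \<alpha> = (\<Sum>j\<in>UNIV. \<alpha> j)"

text \<open>kappa(z,w) e, evaluated at the vertex x\<close>
definition kappa :: "('d::finite \<Rightarrow> 'a set) \<Rightarrow> ('d \<Rightarrow> ('a \<times> 'a) set) \<Rightarrow> ('d \<Rightarrow> 'a) \<Rightarrow> real
     \<Rightarrow> ('d set \<Rightarrow> ('d \<Rightarrow> 'a) set) \<Rightarrow> complex ^ 'd \<Rightarrow> complex ^ 'd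
     \<Rightarrow> (('d \<Rightarrow> 'a) \<Rightarrow> complex) \<Rightarrow> (('d \<Rightarrow> 'a) \<Rightarrow> complex)" where
  "kappa Vt Et rt a Om z w e = (\<lambda>x.
      infsum (\<lambda>\<alpha>. complex_of_real (pochhammer a (mabs \<alpha>) / mfact \<alpha>) * mpow z \<alpha> * cnj (mpow w \<alpha>)) UNIV
        * orth_proj (prodV Vt) (root_line rt) e x
    + (\<Sum>F\<in>{F. F \<noteq> {}}.
        infsum (\<lambda>u.
          infsum (\<lambda>\<alpha>. complex_of_real
                     (mfact (alpha Et rt u) / mfact (\<lambda>j. alpha Et rt u j + \<alpha> j)
                      * pochhammer (real (mabs (alpha Et rt u)) + a) (mabs \<alpha>))
                   * mpow z \<alpha> * cnj (mpow w \<alpha>)) UNIV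
          * orth_proj (prodV Vt) (LuF Vt Et rt a F u) e x) (Om F)))"

section \<open>Holomorphy on the unit ball of C^d\<close>

definition holo_scalar :: "(complex ^ 'd::finite) set \<Rightarrow> (complex ^ 'd \<Rightarrow> complex) \<Rightarrow> bool" where
  "holo_scalar S f \<longleftrightarrow> (\<forall>z\<in>S. \<exists>c :: complex ^ 'd.
       (f has_derivative (\<lambda>h. \<Sum>j\<in>UNIV. c $ j * h $ j)) (at z))"

text \<open>E-valued holomorphic on the ball (weak holomorphy, equivalent to strong holomorphy
  for Hilbert-space valued maps); functions are taken to vanish off the ball\<close>
definition holo_Evalued :: "('d::finite \<Rightarrow> 'a set) \<Rightarrow> (('d \<Rightarrow> 'a) \<Rightarrow> complex) set
      \<Rightarrow> (complex ^ 'd \<Rightarrow> (('d \<Rightarrow> 'a) \<Rightarrow> complex)) \<Rightarrow> bool" where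
  "holo_Evalued Vt E F \<longleftrightarrow>
     (\<forall>z\<in>ball 0 1. F z \<in> E) \<and> (\<forall>z. z \<notin> ball 0 1 \<longrightarrow> F z = (\<lambda>_. 0)) \<and>
     (\<forall>g\<in>l2 (prodV Vt). holo_scalar (ball 0 1) (\<lambda>z. l2_inner (prodV Vt) (F z) g))"

end

(* Up to factors depending on the depth only, the multishift consists of the shifts T_j with weights
   1 / sqrt (card (Chi_j v)). These are doubly commuting isometries with the same joint kernel E as the
   multishift, so l2(V) is the orthogonal sum of the spaces T^alpha E (Wold decomposition). The matrix
   of the decomposition is a product of matrices attached to the factors, so its unitarity reduces to
   a single tree, level by level, where it is finite-dimensional.

   For e in E at depth m, S^alpha e is a multiple of T^alpha e, and the reciprocal of its squared norm
   is |e|^-2 m! / (m + alpha)! * prod_{j < |alpha|} (|m| + a + j). Sending f = sum T^alpha f_alpha to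
   the power series with coefficients sqrt(ratio) f_alpha therefore turns S_j into multiplication by
   z_j. Since finite branching makes E finite-dimensional, everything analytic is scalar: convergence
   and differentiability on the ball follow from the multinomial theorem and Cauchy-Schwarz.

   The spaces L_{u,F} consist of the restrictions of E to the sibling classes, so at each vertex x the
   kernel is multiplication of e(x) by the scalar power series belonging to the depth of x. *)
theory Submission
  imports Defs
begin

section \<open>Homogeneous power series on the unit ball\<close>

text \<open>No basis of \<open>E\<close> is chosen: Wold coefficients are indexed by an exponent and
  a vertex, so on each level the analysis matrix \<open>W\<close> is rectangular.
  \<open>W^T W\<close> is the identity, while \<open>W W^T\<close> is only the projection onto
  \<open>E\<close>-valued families. Both are needed. The first gives Parseval and determines a
  vector by its coefficients; the second shows that a prescribed \<open>E\<close>-valued family is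
  the coefficient family of its synthesis, and this produces the vector representing evaluation at
  \<open>w\<close> explicitly instead of through a Riesz argument.

  The space of functions is the image of \<open>l2\<close> under the model map, with the inner
  product carried over. Unitarity is then built in, and the burden falls on injectivity, that is
  uniqueness of power series coefficients, and on the reproducing identity.

  The terms of degree n cost only a power of n besides norm z ^ n, so every majorant is a polynomial
  times a geometric series, and a derivative merely raises the degree of the polynomial.\<close>

definition hom_idx :: "nat \<Rightarrow> ('d::finite \<Rightarrow> nat) set" where
  "hom_idx n = {\<alpha>. mabs \<alpha> = n}"

lemma le_mabs: "\<alpha> j \<le> mabs (\<alpha> :: 'd::finite \<Rightarrow> nat)"
  unfolding mabs_def by (rule member_le_sum) auto

lemma hom_idx_subset: "hom_idx n \<subseteq> PiE (UNIV :: 'd::finite set) (\<lambda>_. {..n})"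
  using le_mabs by (auto simp: hom_idx_def)

lemma finite_hom_idx: "finite (hom_idx n :: ('d::finite \<Rightarrow> nat) set)"
  by (rule finite_subset[OF hom_idx_subset]) (simp add: finite_PiE)

lemma card_hom_idx: "card (hom_idx n :: ('d::finite \<Rightarrow> nat) set) \<le> (n + 1) ^ CARD('d)"
proof -
  have "card (hom_idx n :: ('d \<Rightarrow> nat) set) \<le> card (PiE (UNIV :: 'd set) (\<lambda>_. {..n}))"
    by (rule card_mono[OF _ hom_idx_subset]) (simp add: finite_PiE)
  then show ?thesis by (simp add: card_PiE)
qed

lemma mabs_Suc: "mabs (\<alpha>(j := Suc (\<alpha> j))) = Suc (mabs (\<alpha> :: 'd::finite \<Rightarrow> nat))"
  unfolding mabs_def by (subst (1 2) sum.remove[of UNIV j]) (auto intro!: sum.cong)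

lemma mfact_Suc: "mfact (\<alpha>(j := Suc (\<alpha> j))) = (real (\<alpha> j) + 1) * mfact (\<alpha> :: 'd::finite \<Rightarrow> nat)"
  unfolding mfact_def by (subst (1 2) prod.remove[of UNIV j]) (auto intro!: prod.cong)

lemma mpow_Suc: "mpow z (\<alpha>(j := Suc (\<alpha> j))) = z $ j * mpow z (\<alpha> :: 'd::finite \<Rightarrow> nat)"
  unfolding mpow_def by (subst (1 2) prod.remove[of UNIV j]) (auto intro!: prod.cong)

lemma mfact_pos: "mfact \<alpha> > 0"
  unfolding mfact_def by (rule prod_pos) simp

text \<open>Raising the \<open>j\<close>-th exponent is a bijection from degree \<open>n\<close>
  onto the exponents of degree \<open>Suc n\<close> with positive \<open>j\<close>-th entry; the
  hypothesis disposes of the others. It serves the multinomial theorem and the reindexing of partial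
  derivatives.\<close>

lemma sum_hom_idx_Suc:
  fixes H :: "('d::finite \<Rightarrow> nat) \<Rightarrow> 'b::comm_monoid_add"
  assumes "\<And>\<alpha>. \<alpha> j = 0 \<Longrightarrow> H \<alpha> = 0"
  shows "(\<Sum>\<alpha>\<in>hom_idx (Suc n). H \<alpha>) = (\<Sum>\<alpha>\<in>hom_idx n. H (\<alpha>(j := Suc (\<alpha> j))))"
proof -
  have "(\<Sum>\<alpha>\<in>hom_idx (Suc n). H \<alpha>) = (\<Sum>\<alpha>\<in>{\<alpha> \<in> hom_idx (Suc n). \<alpha> j > 0}. H \<alpha>)"
    by (rule sum.mono_neutral_right) (auto simp: finite_hom_idx assms)
  also have "\<dots> = (\<Sum>\<alpha>\<in>hom_idx n. H (\<alpha>(j := Suc (\<alpha> j))))"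
  proof (rule sum.reindex_bij_witness[where i = "\<lambda>\<alpha>. \<alpha>(j := Suc (\<alpha> j))" and j = "\<lambda>\<alpha>. \<alpha>(j := \<alpha> j - 1)"])
    fix \<alpha> :: "'d \<Rightarrow> nat" assume \<alpha>: "\<alpha> \<in> {\<alpha> \<in> hom_idx (Suc n). \<alpha> j > 0}"
    show *: "(\<alpha>(j := \<alpha> j - 1))(j := Suc ((\<alpha>(j := \<alpha> j - 1)) j)) = \<alpha>"
      using \<alpha> by auto
    show "\<alpha>(j := \<alpha> j - 1) \<in> hom_idx n"
      using mabs_Suc[of "\<alpha>(j := \<alpha> j - 1)" j] \<alpha> unfolding * by (simp add: hom_idx_def)
  qed (auto simp: hom_idx_def mabs_Suc)
  finally show ?thesis .
qed

text \<open>Induction by Euler's relation for homogeneous functions: in degree \<open>Suc n\<close>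
  the factor \<open>Suc n\<close> is the sum of the entries of \<alpha>, and multiplying by
  \<open>\<alpha> j\<close> cancels one factor of \<alpha>!, leaving \<open>t j\<close> times the
  sum of degree \<open>n\<close>.\<close>

lemma multinomial_theorem:
  fixes t :: "'d::finite \<Rightarrow> real"
  shows "(\<Sum>\<alpha>\<in>hom_idx n. (\<Prod>j\<in>UNIV. t j ^ \<alpha> j) / mfact \<alpha>) = (\<Sum>j\<in>UNIV. t j) ^ n / fact n"
proof (induction n)
  case 0
  have "hom_idx 0 = {\<lambda>_::'d. 0::nat}" by (auto simp: hom_idx_def mabs_def)
  then show ?case by (simp add: mfact_def)
next
  case (Suc n)
  define T where "T \<alpha> = (\<Prod>j\<in>UNIV. t j ^ \<alpha> j) / mfact \<alpha>" for \<alpha>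
  have T: "T (\<alpha>(j := Suc (\<alpha> j))) * (real (\<alpha> j) + 1) = t j * T \<alpha>" for \<alpha> j
  proof -
    have P: "(\<Prod>i\<in>UNIV. t i ^ (\<alpha>(j := Suc (\<alpha> j))) i) = t j * (\<Prod>i\<in>UNIV. t i ^ \<alpha> i)"
      by (subst (1 2) prod.remove[of UNIV j]) (auto intro!: prod.cong)
    have cancel: "x \<noteq> 0 \<Longrightarrow> y / (x * w) * x = y / w" for x y w :: real
      by simp
    show ?thesis
      unfolding T_def mfact_Suc P by (subst cancel) auto
  qed
  have "real (Suc n) * (\<Sum>\<alpha>\<in>hom_idx (Suc n). T \<alpha>) = (\<Sum>\<alpha>\<in>hom_idx (Suc n). \<Sum>j\<in>UNIV. real (\<alpha> j) * T \<alpha>)"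
    unfolding sum_distrib_left
    by (intro sum.cong refl) (simp add: hom_idx_def mabs_def sum_distrib_right[symmetric] flip: of_nat_sum of_nat_Suc)
  also have "\<dots> = (\<Sum>j\<in>UNIV. \<Sum>\<alpha>\<in>hom_idx (Suc n). real (\<alpha> j) * T \<alpha>)"
    by (rule sum.swap)
  also have "\<dots> = (\<Sum>j\<in>UNIV. \<Sum>\<alpha>\<in>hom_idx n. t j * T \<alpha>)"
  proof (rule sum.cong[OF refl])
    fix j
    show "(\<Sum>\<alpha>\<in>hom_idx (Suc n). real (\<alpha> j) * T \<alpha>) = (\<Sum>\<alpha>\<in>hom_idx n. t j * T \<alpha>)"
    proof -
      have "(\<Sum>\<alpha>\<in>hom_idx (Suc n). real (\<alpha> j) * T \<alpha>)
          = (\<Sum>\<alpha>\<in>hom_idx n. real ((\<alpha>(j := Suc (\<alpha> j))) j) * T (\<alpha>(j := Suc (\<alpha> j))))"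
        by (rule sum_hom_idx_Suc) simp
      also have "\<dots> = (\<Sum>\<alpha>\<in>hom_idx n. T (\<alpha>(j := Suc (\<alpha> j))) * (real (\<alpha> j) + 1))"
        by (rule sum.cong[OF refl]) simp
      finally show ?thesis by (simp only: T)
    qed
  qed
  also have "\<dots> = (\<Sum>j\<in>UNIV. t j) * (\<Sum>\<alpha>\<in>hom_idx n. T \<alpha>)"
    by (simp add: sum_product)
  also have "\<dots> = (\<Sum>j\<in>UNIV. t j) ^ Suc n / fact n"
    using Suc by (simp add: T_def)
  finally have "(\<Sum>\<alpha>\<in>hom_idx (Suc n). T \<alpha>) = (\<Sum>j\<in>UNIV. t j) ^ Suc n / fact n / real (Suc n)"
    by (simp add: nonzero_eq_divide_eq mult_ac del: of_nat_Suc)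
  then show ?case
    unfolding T_def by (simp add: mult.commute del: of_nat_Suc)
qed

text \<open>The value \<open>1 / norm (S^\<alpha> e)^2\<close> for a unit vector \<open>e\<close> of the joint kernel concentrated at depth \<open>m\<close>.\<close>
definition ratio :: "real \<Rightarrow> ('d::finite \<Rightarrow> nat) \<Rightarrow> ('d \<Rightarrow> nat) \<Rightarrow> real" where
  "ratio a m \<alpha> = mfact m / mfact (\<lambda>j. m j + \<alpha> j) * pochhammer (real (mabs m) + a) (mabs \<alpha>)"

section \<open>Estimates for the coefficients \<open>ratio\<close>\<close>

lemma ratio_pos: "a > 0 \<Longrightarrow> ratio a m \<alpha> > 0"
  unfolding ratio_def by (intro mult_pos_pos divide_pos_pos mfact_pos pochhammer_pos) simp

lemma ratio_nonneg: "a > 0 \<Longrightarrow> 0 \<le> ratio a m \<alpha>"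
  using ratio_pos less_imp_le by blast

text \<open>The new factor is the reciprocal of the squared depth factor that the weights in
  direction \<open>j\<close> have when leaving depth \<open>m + \<alpha>\<close>. This cancellation
  turns the shift into multiplication by a coordinate.\<close>

lemma ratio_Suc:
  "ratio a m (\<alpha>(j := Suc (\<alpha> j)))
    = ratio a m \<alpha> * ((real (mabs m + mabs \<alpha>) + a) / (real (m j + \<alpha> j) + 1))"
proof -
  have "(\<lambda>i. m i + (\<alpha>(j := Suc (\<alpha> j))) i) = (\<lambda>i. m i + \<alpha> i)(j := Suc (m j + \<alpha> j))"
    by auto
  then have "mfact (\<lambda>i. m i + (\<alpha>(j := Suc (\<alpha> j))) i) = (real (m j + \<alpha> j) + 1) * mfact (\<lambda>i. m i + \<alpha> i)"
    using mfact_Suc[of "\<lambda>i. m i + \<alpha> i" j] by simp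
  then show ?thesis
    unfolding ratio_def mabs_Suc pochhammer_Suc by (simp add: ac_simps)
qed

text \<open>Binomial coefficients are at least 1, so m! \<alpha>! \<le> (m + \<alpha>)!. Within one
  degree only 1 / \<alpha>! then depends on \<alpha>, which is what the multinomial theorem
  sums.\<close>

lemma ratio_le:
  assumes "a > 0"
  shows "ratio a m \<alpha> \<le> pochhammer (real (mabs m) + a) (mabs \<alpha>) / mfact \<alpha>"
proof -
  have "mfact m * mfact \<alpha> \<le> mfact (\<lambda>j. m j + \<alpha> j)"
    unfolding mfact_def prod.distrib[symmetric]
  proof (rule prod_mono, safe)
    fix j
    have "fact (m j) * fact (\<alpha> j) \<le> (fact (m j + \<alpha> j) :: nat)"
      by (rule dvd_imp_le[OF fact_fact_dvd_fact]) simp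
    then show "fact (m j) * fact (\<alpha> j) \<le> (fact (m j + \<alpha> j) :: real)"
      by (metis of_nat_fact of_nat_le_iff of_nat_mult)
  qed simp
  then have "mfact m / mfact (\<lambda>j. m j + \<alpha> j) \<le> 1 / mfact \<alpha>"
    using mfact_pos[of \<alpha>] mfact_pos[of "\<lambda>j. m j + \<alpha> j"] by (simp add: field_simps)
  moreover have "pochhammer (real (mabs m) + a) (mabs \<alpha>) \<ge> 0"
    using assms by (intro less_imp_le pochhammer_pos) simp
  ultimately show ?thesis
    unfolding ratio_def by (metis mult_right_mono times_divide_eq_left mult_1)
qed

text \<open>The quotient is the product of (b + k) / (k + 1) over k < n. Bernoulli's inequality
  bounds each factor by ((k + 2) / (k + 1)) ^ B, and that product telescopes.\<close>

lemma pochhammer_over_fact_le: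
  assumes "b > 0" "b \<le> real B"
  shows "pochhammer b n / fact n \<le> (real n + 1) ^ B"
proof (induction n)
  case (Suc n)
  have "pochhammer b (Suc n) / fact (Suc n) = pochhammer b n / fact n * ((b + n) / (real n + 1))"
    by (simp add: pochhammer_Suc field_simps)
  also have "\<dots> \<le> (real n + 1) ^ B * ((b + n) / (real n + 1))"
    using Suc assms by (intro mult_right_mono) auto
  also have "\<dots> \<le> (real n + 1) ^ B * (1 + 1 / (real n + 1)) ^ B"
  proof (rule mult_left_mono)
    have "(b + n) / (real n + 1) \<le> 1 + real B * (1 / (real n + 1))"
    proof -
      have "(b + n) / (real n + 1) \<le> ((real n + 1) + real B) / (real n + 1)"
        using assms by (intro divide_right_mono) auto
      then show ?thesis by (simp add: add_divide_distrib)
    qed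
    also have "\<dots> \<le> (1 + 1 / (real n + 1)) ^ B"
      by (rule Bernoulli_inequality) (simp add: field_simps)
    finally show "(b + n) / (real n + 1) \<le> (1 + 1 / (real n + 1)) ^ B" .
  qed simp
  also have "\<dots> = (real (Suc n) + 1) ^ B"
  proof -
    have "(real n + 1) * (1 + 1 / (real n + 1)) = real (Suc n) + 1"
      by (simp add: field_simps)
    then show ?thesis unfolding power_mult_distrib[symmetric] by simp
  qed
  finally show ?case .
qed simp

lemma norm_mpow: "cmod (mpow z \<alpha>) = (\<Prod>j\<in>UNIV. cmod (z $ j) ^ \<alpha> j)"
  by (simp add: mpow_def prod_norm[symmetric] norm_power)

lemma sum_cmod_squares: "(\<Sum>j\<in>UNIV. (cmod (z $ j))\<^sup>2) = (norm z)\<^sup>2"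
  by (simp add: norm_vec_def L2_set_def sum_nonneg)

text \<open>The first summand pays for the number of exponents of degree \<open>n\<close> in
  Cauchy-Schwarz, the second for \<open>pochhammer b n / fact n\<close> with
  \<open>b = mabs m + a\<close>.\<close>

definition growth :: "real \<Rightarrow> ('d::finite \<Rightarrow> nat) \<Rightarrow> nat" where
  "growth a m = CARD('d) + nat \<lceil>real (mabs m) + a\<rceil>"

text \<open>Cauchy-Schwarz against the constant 1 reduces the claim to the sum of squares, which
  \<open>ratio_le\<close> and the multinomial theorem bound by
  \<open>pochhammer b n / fact n * norm z ^ (2 * n)\<close>. Here the Euclidean ball
  appears.\<close>

lemma sum_ratio_mpow_le:
  fixes z :: "complex ^ 'd::finite"
  assumes a: "a > 0" and z: "norm z \<le> \<rho>"
  shows "(\<Sum>\<alpha>\<in>hom_idx n. sqrt (ratio a m \<alpha>) * cmod (mpow z \<alpha>)) \<le> (real n + 1) ^ growth a m * \<rho> ^ n"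
proof -
  define b B where "b = real (mabs m) + a" and "B = nat \<lceil>b\<rceil>"
  have b: "b > 0" "b \<le> real B" using a by (auto simp: b_def B_def)
  have rho: "\<rho> \<ge> 0" using z norm_ge_zero order_trans by blast
  have "(\<Sum>\<alpha>\<in>hom_idx n. ratio a m \<alpha> * (cmod (mpow z \<alpha>))\<^sup>2)
      \<le> (\<Sum>\<alpha>\<in>hom_idx n. pochhammer b n * ((\<Prod>j\<in>UNIV. ((cmod (z $ j))\<^sup>2) ^ \<alpha> j) / mfact \<alpha>))"
  proof (rule sum_mono)
    fix \<alpha> :: "'d \<Rightarrow> nat" assume "\<alpha> \<in> hom_idx n"
    then have "ratio a m \<alpha> \<le> pochhammer b n / mfact \<alpha>"
      using ratio_le[OF a, of m \<alpha>] by (simp add: hom_idx_def b_def)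
    then have "ratio a m \<alpha> * (cmod (mpow z \<alpha>))\<^sup>2 \<le> pochhammer b n / mfact \<alpha> * (cmod (mpow z \<alpha>))\<^sup>2"
      by (rule mult_right_mono) simp
    moreover have "(cmod (mpow z \<alpha>))\<^sup>2 = (\<Prod>j\<in>UNIV. ((cmod (z $ j))\<^sup>2) ^ \<alpha> j)"
      unfolding norm_mpow prod_power_distrib
      by (intro prod.cong refl) (simp add: power_mult[symmetric] mult.commute)
    ultimately show "ratio a m \<alpha> * (cmod (mpow z \<alpha>))\<^sup>2
        \<le> pochhammer b n * ((\<Prod>j\<in>UNIV. ((cmod (z $ j))\<^sup>2) ^ \<alpha> j) / mfact \<alpha>)" by simp
  qed
  also have "\<dots> = pochhammer b n * ((norm z)\<^sup>2 ^ n / fact n)"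
    unfolding sum_distrib_left[symmetric] multinomial_theorem sum_cmod_squares ..
  also have "\<dots> = pochhammer b n / fact n * (norm z)\<^sup>2 ^ n" by simp
  also have "\<dots> \<le> (real n + 1) ^ B * (\<rho> ^ n)\<^sup>2"
  proof (rule mult_mono)
    show "pochhammer b n / fact n \<le> (real n + 1) ^ B" using pochhammer_over_fact_le b .
    have "norm z ^ n \<le> \<rho> ^ n" using z by (rule power_mono) simp
    then show "(norm z)\<^sup>2 ^ n \<le> (\<rho> ^ n)\<^sup>2"
      by (simp add: power_mono flip: power_mult) (metis mult.commute power_mono power_mult zero_le_power norm_ge_zero)
  qed auto
  finally have sq: "(\<Sum>\<alpha>\<in>hom_idx n. ratio a m \<alpha> * (cmod (mpow z \<alpha>))\<^sup>2) \<le> (real n + 1) ^ B * (\<rho> ^ n)\<^sup>2" .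
  define u where "u \<alpha> = sqrt (ratio a m \<alpha>) * cmod (mpow z \<alpha>)" for \<alpha>
  have "(\<Sum>\<alpha>\<in>hom_idx n. u \<alpha>)\<^sup>2 \<le> (\<Sum>\<alpha>\<in>hom_idx n. (u \<alpha>)\<^sup>2) * real (card (hom_idx n :: ('d \<Rightarrow> nat) set))"
    using Cauchy_Schwarz_ineq_sum[of u "\<lambda>_. 1" "hom_idx n"] by simp
  also have "(\<Sum>\<alpha>\<in>hom_idx n. (u \<alpha>)\<^sup>2) = (\<Sum>\<alpha>\<in>hom_idx n. ratio a m \<alpha> * (cmod (mpow z \<alpha>))\<^sup>2)"
    by (simp add: u_def power_mult_distrib ratio_nonneg[OF a])
  also have "\<dots> * real (card (hom_idx n :: ('d \<Rightarrow> nat) set))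
      \<le> ((real n + 1) ^ B * (\<rho> ^ n)\<^sup>2) * (real n + 1) ^ CARD('d)"
  proof (rule mult_mono[OF sq])
    show "real (card (hom_idx n :: ('d \<Rightarrow> nat) set)) \<le> (real n + 1) ^ CARD('d)"
      using card_hom_idx[where 'd='d, of n] by (metis of_nat_1 of_nat_add of_nat_le_iff of_nat_power)
  qed auto
  also have "\<dots> = (real n + 1) ^ growth a m * (\<rho> ^ n)\<^sup>2"
    by (simp add: growth_def B_def b_def power_add mult_ac)
  \<comment> \<open>Squaring the polynomial factor is wasteful, but makes the bound a perfect square
    whose root is again an integral power.\<close>
  also have "\<dots> \<le> ((real n + 1) ^ growth a m)\<^sup>2 * (\<rho> ^ n)\<^sup>2"
  proof (rule mult_right_mono)
    have "1 \<le> (real n + 1) ^ growth a m" by (rule one_le_power) simp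
    then show "(real n + 1) ^ growth a m \<le> ((real n + 1) ^ growth a m)\<^sup>2"
      by (simp add: self_le_power)
  qed simp
  finally have "(\<Sum>\<alpha>\<in>hom_idx n. u \<alpha>)\<^sup>2 \<le> ((real n + 1) ^ growth a m * \<rho> ^ n)\<^sup>2"
    by (simp add: power_mult_distrib)
  then have "(\<Sum>\<alpha>\<in>hom_idx n. u \<alpha>) \<le> (real n + 1) ^ growth a m * \<rho> ^ n"
    by (rule power2_le_imp_le) (use rho in simp)
  then show ?thesis by (simp only: u_def)
qed

section \<open>Convergence on the ball, summing by total degree\<close>

lemma summable_power_times_geometric:
  assumes "0 \<le> \<rho>" "\<rho> < (1::real)"
  shows "summable (\<lambda>n. (real n + 1) ^ D * \<rho> ^ n)"
proof -
  have "(\<lambda>n. (1 + inverse (real (Suc n))) ^ D * \<rho>) \<longlonglongrightarrow> (1 + 0) ^ D * \<rho>"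
    by (intro tendsto_intros LIMSEQ_inverse_real_of_nat)
  then have "(\<lambda>n. (1 + inverse (real (Suc n))) ^ D * \<rho>) \<longlonglongrightarrow> \<rho>" by simp
  moreover have "\<rho> < (1 + \<rho>) / 2" using assms by simp
  ultimately have "\<forall>\<^sub>F n in sequentially. (1 + inverse (real (Suc n))) ^ D * \<rho> < (1 + \<rho>) / 2"
    by (rule order_tendstoD)
  then obtain N where N: "\<And>n. n \<ge> N \<Longrightarrow> (1 + inverse (real (Suc n))) ^ D * \<rho> < (1 + \<rho>) / 2"
    unfolding eventually_sequentially by blast
  show ?thesis
  proof (rule summable_ratio_test)
    show "(1 + \<rho>) / 2 < 1" using assms by simp
    fix n assume n: "n \<ge> N"
    have "real (Suc n) + 1 = (1 + inverse (real (Suc n))) * (real n + 1)"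
      by (simp add: field_simps)
    then have "(real (Suc n) + 1) ^ D * \<rho> ^ Suc n
        = ((1 + inverse (real (Suc n))) ^ D * \<rho>) * ((real n + 1) ^ D * \<rho> ^ n)"
      by (simp only: power_mult_distrib power_Suc mult_ac)
    also have "\<dots> \<le> (1 + \<rho>) / 2 * ((real n + 1) ^ D * \<rho> ^ n)"
      using N[OF n] assms by (intro mult_right_mono) auto
    finally show "norm ((real (Suc n) + 1) ^ D * \<rho> ^ Suc n) \<le> (1 + \<rho>) / 2 * norm ((real n + 1) ^ D * \<rho> ^ n)"
      using assms by simp
  qed
qed

text \<open>A finite set of exponents has bounded degree, so its sum is at most a partial sum of
  \<open>M\<close>. Series indexed by degree thus control unordered sums.\<close>

lemma summable_on_homogeneous:
  fixes F :: "('d::finite \<Rightarrow> nat) \<Rightarrow> real"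
  assumes nonneg: "\<And>\<alpha>. F \<alpha> \<ge> 0" and le: "\<And>n. (\<Sum>\<alpha>\<in>hom_idx n. F \<alpha>) \<le> M n" and M: "summable M"
  shows "F summable_on UNIV"
proof (rule nonneg_bdd_above_summable_on)
  show "bdd_above (sum F ` {A. A \<subseteq> UNIV \<and> finite A})"
  proof (rule bdd_aboveI2)
    fix A :: "('d \<Rightarrow> nat) set" assume "A \<in> {A. A \<subseteq> UNIV \<and> finite A}"
    then have A: "finite A" by simp
    define N where "N = Suc (Max (insert 0 (mabs ` A)))"
    have sub: "A \<subseteq> (\<Union>n<N. hom_idx n)"
      using A by (auto simp: N_def hom_idx_def less_Suc_eq_le)
    have "sum F A \<le> sum F (\<Union>n<N. hom_idx n)"
      by (rule sum_mono2[OF _ sub]) (auto simp: finite_hom_idx nonneg)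
    also have "\<dots> = (\<Sum>n<N. \<Sum>\<alpha>\<in>hom_idx n. F \<alpha>)"
      by (rule sum.UNION_disjoint) (auto simp: finite_hom_idx, auto simp: hom_idx_def)
    also have "\<dots> \<le> (\<Sum>n<N. M n)" by (rule sum_mono) (rule le)
    also have "\<dots> \<le> suminf M"
    proof (rule sum_le_suminf[OF M])
      fix n
      have "0 \<le> (\<Sum>\<alpha>\<in>hom_idx n. F \<alpha>)" by (rule sum_nonneg) (rule nonneg)
      then show "0 \<le> M n" using le order_trans by blast
    qed simp
    finally show "sum F A \<le> suminf M" .
  qed
qed (rule nonneg)

lemma homogeneous_sums:
  fixes F :: "('d::finite \<Rightarrow> nat) \<Rightarrow> complex"
  assumes "F summable_on UNIV"
  shows "(\<lambda>n. \<Sum>\<alpha>\<in>hom_idx n. F \<alpha>) sums infsum F UNIV"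
proof -
  have bij: "bij_betw snd (Sigma (UNIV :: nat set) hom_idx) (UNIV :: ('d \<Rightarrow> nat) set)"
    by (rule bij_betwI[where g = "\<lambda>\<alpha>. (mabs \<alpha>, \<alpha>)"]) (auto simp: hom_idx_def)
  have "(F has_sum infsum F UNIV) UNIV" using assms by simp
  then have "((\<lambda>p. F (snd p)) has_sum infsum F UNIV) (Sigma UNIV hom_idx)"
    by (subst has_sum_reindex_bij_betw[OF bij])
  then have "((\<lambda>n. \<Sum>\<alpha>\<in>hom_idx n. F \<alpha>) has_sum infsum F UNIV) UNIV"
    by (rule has_sum_SigmaD) (simp add: finite_hom_idx)
  then show ?thesis by (rule has_sum_imp_sums)
qed

lemma summable_ratio_mpow:
  fixes z :: "complex ^ 'd::finite"
  assumes "a > 0" "norm z < 1"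
  shows "(\<lambda>\<alpha>. sqrt (ratio a m \<alpha>) * cmod (mpow z \<alpha>)) summable_on UNIV"
  by (rule summable_on_homogeneous[OF _ sum_ratio_mpow_le[OF assms(1) order_refl]
        summable_power_times_geometric[OF norm_ge_zero assms(2)]])
    (simp add: ratio_nonneg[OF assms(1)])

text \<open>A summable nonnegative family is bounded by its sum, hence its squares are summable too.
  This gives the kernel vectors finite norm.\<close>

lemma summable_ratio_mpow_square:
  fixes z :: "complex ^ 'd::finite"
  assumes "a > 0" "norm z < 1"
  shows "(\<lambda>\<alpha>. ratio a m \<alpha> * (cmod (mpow z \<alpha>))\<^sup>2) summable_on UNIV"
proof -
  define u where "u \<alpha> = sqrt (ratio a m \<alpha>) * cmod (mpow z \<alpha>)" for \<alpha>
  have u: "u summable_on UNIV" "\<And>\<alpha>. u \<alpha> \<ge> 0"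
    using summable_ratio_mpow[OF assms, of m] by (auto simp: u_def[abs_def] ratio_nonneg[OF assms(1)])
  have "u \<alpha> \<le> infsum u UNIV" for \<alpha>
    using finite_sum_le_infsum[OF u(1), of "{\<alpha>}"] u(2) by simp
  then have "(\<lambda>\<alpha>. u \<alpha> * u \<alpha>) summable_on UNIV"
    using u(2) by (intro summable_on_comparison_test[OF summable_on_cmult_right[OF u(1), of "infsum u UNIV"]])
      (auto intro: mult_right_mono)
  moreover have "u \<alpha> * u \<alpha> = ratio a m \<alpha> * (cmod (mpow z \<alpha>))\<^sup>2" for \<alpha>
    using ratio_pos[OF assms(1), of m \<alpha>] by (simp add: u_def power2_eq_square[symmetric] power_mult_distrib)
  ultimately show ?thesis by simp
qed

text \<open>The bound on \<open>c\<close> is the one met by the model at each vertex: a bounded Wold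
  coefficient times the square root of \<open>ratio\<close>.\<close>

lemma summable_power_series:
  fixes z :: "complex ^ 'd::finite"
  assumes "a > 0" "norm z < 1" "\<And>\<alpha>. cmod (c \<alpha>) \<le> C * sqrt (ratio a m \<alpha>)"
  shows "(\<lambda>\<alpha>. c \<alpha> * mpow z \<alpha>) summable_on UNIV"
proof (rule abs_summable_summable, rule summable_on_comparison_test)
  show "(\<lambda>\<alpha>. C * (sqrt (ratio a m \<alpha>) * cmod (mpow z \<alpha>))) summable_on UNIV"
    by (rule summable_on_cmult_right[OF summable_ratio_mpow[OF assms(1,2)]])
qed (auto simp: norm_mult mult.assoc[symmetric] intro!: mult_right_mono assms(3))

section \<open>Termwise differentiation\<close>

lemma mpow_has_derivative:
  fixes z :: "complex ^ 'd::finite"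
  shows "((\<lambda>z. mpow z \<alpha>) has_derivative
    (\<lambda>h. \<Sum>j\<in>UNIV. of_nat (\<alpha> j) * mpow z (\<alpha>(j := \<alpha> j - 1)) * h $ j)) (at z within S)"
proof -
  \<comment> \<open>If \<open>\<alpha> j = 0\<close>, the truncated exponent
    \<open>\<alpha> j - 1\<close> is 0, and the factor \<open>\<alpha> j\<close> makes the term
    vanish.\<close>
  have "((\<lambda>z. (z $ j) ^ \<alpha> j) has_derivative (\<lambda>h. of_nat (\<alpha> j) * (h $ j * (z $ j) ^ (\<alpha> j - 1)))) (at z within S)" for j
  proof -
    have "((\<lambda>z :: complex ^ 'd. z $ j) has_derivative (\<lambda>h. h $ j)) (at z within S)"
      by (rule bounded_linear.has_derivative[OF bounded_linear_vec_nth has_derivative_ident])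
    from has_derivative_power[OF this, of "\<alpha> j"] show ?thesis by (simp add: mult.assoc)
  qed
  then have "((\<lambda>z. \<Prod>j\<in>UNIV. (z $ j) ^ \<alpha> j) has_derivative
     (\<lambda>h. \<Sum>j\<in>UNIV. (of_nat (\<alpha> j) * (h $ j * (z $ j) ^ (\<alpha> j - 1))) * (\<Prod>i\<in>UNIV - {j}. (z $ i) ^ \<alpha> i))) (at z within S)"
    by (rule has_derivative_prod)
  moreover have "mpow z (\<alpha>(j := \<alpha> j - 1)) = (z $ j) ^ (\<alpha> j - 1) * (\<Prod>i\<in>UNIV - {j}. (z $ i) ^ \<alpha> i)" for j
    unfolding mpow_def by (subst prod.remove[of UNIV j]) (auto intro!: prod.cong)
  ultimately show ?thesis by (simp add: mpow_def[abs_def] mult_ac)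
qed

text \<open>A partial derivative multiplies the coefficient at the raised exponent by s = \<alpha> j
  + 1. With p = |m| + |\<alpha>| + a, \<open>ratio_Suc\<close> gives the squared cost p s^2 / (m j +
  s) \<le> p s, so the loss is only linear in the degree.\<close>

lemma sqrt_ratio_Suc_le:
  assumes "a > 0"
  shows "sqrt (ratio a m (\<alpha>(j := Suc (\<alpha> j)))) * (real (\<alpha> j) + 1)
    \<le> (real (mabs m + mabs \<alpha>) + a + 1) * sqrt (ratio a m \<alpha>)"
proof (rule power2_le_imp_le)
  define p where "p = real (mabs m + mabs \<alpha>) + a"
  define s where "s = real (\<alpha> j) + 1"
  have p: "p \<ge> 0" using assms by (simp add: p_def)
  have s: "s \<ge> 1" "s \<le> p + 1" "s \<le> real (m j + \<alpha> j) + 1"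
    using le_mabs[of \<alpha> j] assms by (auto simp: s_def p_def)
  have r: "ratio a m \<alpha> > 0" "ratio a m (\<alpha>(j := Suc (\<alpha> j))) > 0" using ratio_pos assms by auto
  have "p / (real (m j + \<alpha> j) + 1) * s\<^sup>2 \<le> p / s * s\<^sup>2"
    using p s by (intro mult_right_mono divide_left_mono) auto
  also have "\<dots> = p * s" using s by (simp add: power2_eq_square)
  also have "\<dots> \<le> (p + 1) * (p + 1)" using p s by (intro mult_mono) auto
  finally have *: "p / (real (m j + \<alpha> j) + 1) * s\<^sup>2 \<le> (p + 1)\<^sup>2" by (simp add: power2_eq_square)
  have "(sqrt (ratio a m (\<alpha>(j := Suc (\<alpha> j)))) * s)\<^sup>2 = ratio a m \<alpha> * (p / (real (m j + \<alpha> j) + 1) * s\<^sup>2)"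
    using r by (simp add: power_mult_distrib ratio_Suc p_def)
  also have "\<dots> \<le> ratio a m \<alpha> * (p + 1)\<^sup>2"
    using * r by (intro mult_left_mono) auto
  also have "\<dots> = ((p + 1) * sqrt (ratio a m \<alpha>))\<^sup>2"
    using r by (simp add: power_mult_distrib)
  finally show "(sqrt (ratio a m (\<alpha>(j := Suc (\<alpha> j)))) * (real (\<alpha> j) + 1))\<^sup>2
      \<le> ((real (mabs m + mabs \<alpha>) + a + 1) * sqrt (ratio a m \<alpha>))\<^sup>2"
    by (simp add: p_def s_def)
qed (use assms ratio_pos[of a m \<alpha>] in auto)

text \<open>The homogeneous parts \<open>f n\<close> are differentiated one by one on a smaller ball
  about 0. Their partial derivatives \<open>D j n\<close> have the summable majorant
  \<open>M\<close>, so the Weierstrass test supplies the uniform convergence required for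
  differentiating the series.\<close>

lemma power_series_holo:
  fixes c :: "('d::finite \<Rightarrow> nat) \<Rightarrow> complex"
  assumes a: "a > 0" and c: "\<And>\<alpha>. cmod (c \<alpha>) \<le> C * sqrt (ratio a m \<alpha>)"
  shows "holo_scalar (ball 0 1) (\<lambda>z. infsum (\<lambda>\<alpha>. c \<alpha> * mpow z \<alpha>) UNIV)"
  unfolding holo_scalar_def
proof
  fix z0 :: "complex ^ 'd" assume z0: "z0 \<in> ball 0 1"
  \<comment> \<open>A radius strictly between \<open>norm z0\<close> and 1: the ball
    \<open>S\<close> contains \<open>z0\<close> and the majorant stays geometric.\<close>
  define \<rho> where "\<rho> = (1 + norm z0) / 2"
  have \<rho>: "norm z0 < \<rho>" "\<rho> < 1" "0 \<le> \<rho>" using z0 by (auto simp: \<rho>_def)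
  define S where "S = ball (0 :: complex ^ 'd) \<rho>"
  define f where "f n z = (\<Sum>\<alpha>\<in>hom_idx n. c \<alpha> * mpow z \<alpha>)" for n and z :: "complex ^ 'd"
  define D where "D j n z = (\<Sum>\<alpha>\<in>hom_idx n. c \<alpha> * (of_nat (\<alpha> j) * mpow z (\<alpha>(j := \<alpha> j - 1))))" for j n and z :: "complex ^ 'd"
  \<comment> \<open>Differentiation lowers the degree by one, hence the shifted index and the value
    0 in degree 0. The extra power in \<open>Suc (growth a m)\<close> absorbs the linear loss of
    \<open>sqrt_ratio_Suc_le\<close>.\<close>
  define M where "M n = (case n of 0 \<Rightarrow> 0 | Suc l \<Rightarrow> \<bar>C\<bar> * (real (mabs m) + a + 1) * ((real l + 1) ^ Suc (growth a m) * \<rho> ^ l))" for n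
  have C: "C \<ge> 0"
  proof -
    have "0 \<le> C * sqrt (ratio a m (\<lambda>_. 0))" using c[of "\<lambda>_. 0"] norm_ge_zero order_trans by blast
    then show ?thesis using ratio_pos[OF a, of m "\<lambda>_. 0"] by (simp add: zero_le_mult_iff)
  qed
  have M: "summable M"
  proof -
    have "summable (\<lambda>n. M (Suc n))"
      unfolding M_def nat.case by (intro summable_mult summable_power_times_geometric \<rho>)
    then show ?thesis by (subst (asm) summable_Suc_iff)
  qed
  have DM: "cmod (D j n z) \<le> M n" if "z \<in> S" for j n z
  proof (cases n)
    case 0
    have "\<alpha> j = 0" if "\<alpha> \<in> hom_idx 0" for \<alpha>
      using that le_mabs[of \<alpha> j] by (simp add: hom_idx_def)
    then have "D j 0 z = 0" unfolding D_def by (intro sum.neutral) auto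
    then show ?thesis using 0 by (simp add: M_def)
  next
    case (Suc l)
    have z: "norm z \<le> \<rho>" using that by (simp add: S_def)
    have "D j n z = (\<Sum>\<alpha>\<in>hom_idx l. c (\<alpha>(j := Suc (\<alpha> j))) * ((of_nat (\<alpha> j) + 1) * mpow z \<alpha>))"
      unfolding D_def Suc by (subst sum_hom_idx_Suc[where j=j]) (auto simp: add.commute)
    also have "cmod \<dots> \<le> (\<Sum>\<alpha>\<in>hom_idx l. (C * (real (mabs m) + real l + a + 1)) * (sqrt (ratio a m \<alpha>) * cmod (mpow z \<alpha>)))"
    proof (rule sum_norm_le)
      fix \<alpha> :: "'d \<Rightarrow> nat" assume \<alpha>: "\<alpha> \<in> hom_idx l"
      have "cmod (of_nat (\<alpha> j) + 1) = real (\<alpha> j) + 1"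
        by (metis norm_of_nat of_nat_Suc add.commute)
      then have "cmod (c (\<alpha>(j := Suc (\<alpha> j))) * ((of_nat (\<alpha> j) + 1) * mpow z \<alpha>))
          = cmod (c (\<alpha>(j := Suc (\<alpha> j)))) * (real (\<alpha> j) + 1) * cmod (mpow z \<alpha>)"
        by (simp add: norm_mult)
      also have "\<dots> \<le> C * sqrt (ratio a m (\<alpha>(j := Suc (\<alpha> j)))) * (real (\<alpha> j) + 1) * cmod (mpow z \<alpha>)"
        by (intro mult_right_mono c) auto
      also have "\<dots> = C * (sqrt (ratio a m (\<alpha>(j := Suc (\<alpha> j)))) * (real (\<alpha> j) + 1)) * cmod (mpow z \<alpha>)"
        by simp
      also have "\<dots> \<le> C * ((real (mabs m + mabs \<alpha>) + a + 1) * sqrt (ratio a m \<alpha>)) * cmod (mpow z \<alpha>)"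
        by (intro mult_right_mono mult_left_mono sqrt_ratio_Suc_le a C) auto
      also have "\<dots> = (C * (real (mabs m) + real l + a + 1)) * (sqrt (ratio a m \<alpha>) * cmod (mpow z \<alpha>))"
        using \<alpha> by (simp add: hom_idx_def)
      finally show "cmod (c (\<alpha>(j := Suc (\<alpha> j))) * ((of_nat (\<alpha> j) + 1) * mpow z \<alpha>)) \<le> \<dots>" .
    qed
    also have "\<dots> = (C * (real (mabs m) + real l + a + 1)) * (\<Sum>\<alpha>\<in>hom_idx l. sqrt (ratio a m \<alpha>) * cmod (mpow z \<alpha>))"
      by (rule sum_distrib_left[symmetric])
    also have "\<dots> \<le> (C * ((real (mabs m) + a + 1) * (real l + 1))) * ((real l + 1) ^ growth a m * \<rho> ^ l)"
    proof (rule mult_mono)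
      have "real (mabs m) + real l + a + 1 \<le> (real (mabs m) + a + 1) * (real l + 1)"
        using a by (simp add: algebra_simps)
      then show "C * (real (mabs m) + real l + a + 1) \<le> C * ((real (mabs m) + a + 1) * (real l + 1))"
        using C by (rule mult_left_mono)
      show "(\<Sum>\<alpha>\<in>hom_idx l. sqrt (ratio a m \<alpha>) * cmod (mpow z \<alpha>)) \<le> (real l + 1) ^ growth a m * \<rho> ^ l"
        using sum_ratio_mpow_le[OF a z] .
      show "0 \<le> C * ((real (mabs m) + a + 1) * (real l + 1))" using a C by simp
      show "0 \<le> (\<Sum>\<alpha>\<in>hom_idx l. sqrt (ratio a m \<alpha>) * cmod (mpow z \<alpha>))"
        using ratio_nonneg[OF a] by (intro sum_nonneg mult_nonneg_nonneg) auto
    qed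
    also have "\<dots> = M n" using C by (simp add: M_def Suc mult_ac)
    finally show ?thesis .
  qed
  have unif: "uniform_limit S (\<lambda>n z. \<Sum>i<n. D j i z) (\<lambda>z. suminf (\<lambda>i. D j i z)) sequentially" for j
    using DM M by (rule Weierstrass_m_test)
  define G where "G z h = (\<Sum>j\<in>UNIV. suminf (\<lambda>i. D j i z) * h $ j)" for z and h :: "complex ^ 'd"
  have "\<exists>g. \<forall>z\<in>S. (\<lambda>n. f n z) sums g z \<and> (g has_derivative G z) (at z within S)"
  proof (rule has_derivative_series[where f' = "\<lambda>n z h. \<Sum>j\<in>UNIV. D j n z * h $ j"])
    show "convex S" by (simp add: S_def)
    show "0 \<in> S" using z0 by (auto simp: S_def \<rho>_def add_pos_nonneg)
    fix n and z :: "complex ^ 'd" assume "z \<in> S"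
    have "(f n has_derivative (\<lambda>h. \<Sum>\<alpha>\<in>hom_idx n. c \<alpha> * (\<Sum>j\<in>UNIV. of_nat (\<alpha> j) * mpow z (\<alpha>(j := \<alpha> j - 1)) * h $ j))) (at z within S)"
      unfolding f_def[abs_def] by (intro has_derivative_sum has_derivative_mult_right mpow_has_derivative)
    moreover have "(\<Sum>\<alpha>\<in>hom_idx n. c \<alpha> * (\<Sum>j\<in>UNIV. of_nat (\<alpha> j) * mpow z (\<alpha>(j := \<alpha> j - 1)) * h $ j))
        = (\<Sum>j\<in>UNIV. D j n z * h $ j)" for h
      unfolding D_def sum_distrib_left sum_distrib_right by (subst sum.swap) (simp add: mult_ac)
    ultimately show "(f n has_derivative (\<lambda>h. \<Sum>j\<in>UNIV. D j n z * h $ j)) (at z within S)" by simp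
  next
    fix e :: real assume e: "e > 0"
    define e' where "e' = e / real CARD('d)"
    have "e' > 0" using e by (simp add: e'_def)
    then have "\<forall>\<^sub>F n in sequentially. \<forall>j. \<forall>z\<in>S. dist (\<Sum>i<n. D j i z) (suminf (\<lambda>i. D j i z)) < e'"
      using unif by (auto simp: uniform_limit_iff eventually_all_finite)
    then show "\<forall>\<^sub>F n in sequentially. \<forall>z\<in>S. \<forall>h. norm ((\<Sum>i<n. \<Sum>j\<in>UNIV. D j i z * h $ j) - G z h) \<le> e * norm h"
    proof (rule eventually_mono, intro ballI allI)
      fix n z h assume n: "\<forall>j. \<forall>z\<in>S. dist (\<Sum>i<n. D j i z) (suminf (\<lambda>i. D j i z)) < e'" and z: "z \<in> S"
      have "(\<Sum>i<n. \<Sum>j\<in>UNIV. D j i z * h $ j) - G z h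
          = (\<Sum>j\<in>UNIV. ((\<Sum>i<n. D j i z) - suminf (\<lambda>i. D j i z)) * h $ j)"
        unfolding G_def by (subst sum.swap) (simp add: sum_distrib_right sum_subtractf left_diff_distrib)
      also have "norm \<dots> \<le> (\<Sum>j\<in>(UNIV::'d set). e' * norm h)"
      proof (rule sum_norm_le)
        fix j
        have "cmod ((\<Sum>i<n. D j i z) - suminf (\<lambda>i. D j i z)) \<le> e'"
          using n z by (simp add: dist_norm less_imp_le)
        then show "cmod (((\<Sum>i<n. D j i z) - suminf (\<lambda>i. D j i z)) * h $ j) \<le> e' * norm h"
          unfolding norm_mult using \<open>e' > 0\<close> by (intro mult_mono Finite_Cartesian_Product.norm_nth_le) auto
      qed
      also have "\<dots> = e * norm h" by (simp add: e'_def)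
      finally show "norm ((\<Sum>i<n. \<Sum>j\<in>UNIV. D j i z * h $ j) - G z h) \<le> e * norm h" .
    qed
  next
    show "(\<lambda>n. f n 0) sums infsum (\<lambda>\<alpha>. c \<alpha> * mpow 0 \<alpha>) UNIV"
      unfolding f_def by (rule homogeneous_sums, rule summable_power_series[OF a _ c]) simp
  qed
  then obtain g where g: "\<And>z. z \<in> S \<Longrightarrow> (\<lambda>n. f n z) sums g z"
    "\<And>z. z \<in> S \<Longrightarrow> (g has_derivative G z) (at z within S)" by blast
  have S: "open S" "z0 \<in> S" using \<rho> by (auto simp: S_def)
  have "infsum (\<lambda>\<alpha>. c \<alpha> * mpow z \<alpha>) UNIV = g z" if "z \<in> S" for z
  proof -
    have "norm z < 1" using that \<rho> by (simp add: S_def)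
    then have "(\<lambda>n. f n z) sums infsum (\<lambda>\<alpha>. c \<alpha> * mpow z \<alpha>) UNIV"
      unfolding f_def by (intro homogeneous_sums summable_power_series[OF a _ c])
    then show ?thesis using g(1)[OF that] sums_unique2 by blast
  qed
  then have eq: "g z = infsum (\<lambda>\<alpha>. c \<alpha> * mpow z \<alpha>) UNIV" if "z \<in> S" for z
    using that by simp
  have "(g has_derivative G z0) (at z0)"
    using g(2)[OF S(2)] unfolding at_within_open[OF S(2,1)] .
  then have "((\<lambda>z. infsum (\<lambda>\<alpha>. c \<alpha> * mpow z \<alpha>) UNIV) has_derivative G z0) (at z0)"
    by (rule has_derivative_transform_within_open[OF _ S eq])
  then have "((\<lambda>z. infsum (\<lambda>\<alpha>. c \<alpha> * mpow z \<alpha>) UNIV) has_derivative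
      (\<lambda>h. \<Sum>j\<in>UNIV. (\<chi> j. suminf (\<lambda>i. D j i z0)) $ j * h $ j)) (at z0)"
    by (simp add: G_def[abs_def])
  then show "\<exists>d :: complex ^ 'd. ((\<lambda>z. infsum (\<lambda>\<alpha>. c \<alpha> * mpow z \<alpha>) UNIV) has_derivative
      (\<lambda>h. \<Sum>j\<in>UNIV. d $ j * h $ j)) (at z0)" by blast
qed

text \<open>The third assumption says that the exponents in \<open>A\<close> are already told apart by their values on \<open>J\<close>;
  it makes the induction over \<open>J\<close> work without re-indexing the polynomial.\<close>
lemma polynomial_eq_0:
  fixes c :: "('d \<Rightarrow> nat) \<Rightarrow> complex"
  assumes "finite J" "finite A"
    and "\<And>\<alpha> \<beta>. \<alpha> \<in> A \<Longrightarrow> \<beta> \<in> A \<Longrightarrow> (\<And>j. j \<in> J \<Longrightarrow> \<alpha> j = \<beta> j) \<Longrightarrow> \<alpha> = \<beta>"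
    and "\<And>z. (\<Sum>\<alpha>\<in>A. c \<alpha> * (\<Prod>j\<in>J. z j ^ \<alpha> j)) = 0"
    and "\<gamma> \<in> A"
  shows "c \<gamma> = 0"
  using assms
proof (induction J arbitrary: A rule: finite_induct)
  case empty
  then have "A = {\<gamma>}" by auto
  then show ?case using empty.prems(3) by simp
next
  case (insert i J)
  define N where "N = Max ((\<lambda>\<alpha>. \<alpha> i) ` A)"
  have N: "\<alpha> i \<le> N" if "\<alpha> \<in> A" for \<alpha> using that insert.prems(1) by (auto simp: N_def)
  have "(\<Sum>\<alpha>\<in>{\<alpha> \<in> A. \<alpha> i = \<gamma> i}. c \<alpha> * (\<Prod>j\<in>J. z j ^ \<alpha> j)) = 0" for z
  proof -
    \<comment> \<open>With the other variables frozen, \<open>q k\<close> is the coefficient of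
      \<open>x ^ k\<close> in a polynomial of the single variable \<open>x\<close> that vanishes
      identically.\<close>
    define q where "q k = (\<Sum>\<alpha>\<in>{\<alpha> \<in> A. \<alpha> i = k}. c \<alpha> * (\<Prod>j\<in>J. z j ^ \<alpha> j))" for k
    have "(\<Sum>k\<le>N. q k * x ^ k) = 0" for x
    proof -
      have "(\<Sum>k\<le>N. q k * x ^ k) = (\<Sum>k\<le>N. \<Sum>\<alpha>\<in>{\<alpha> \<in> A. \<alpha> i = k}. c \<alpha> * (x ^ \<alpha> i * (\<Prod>j\<in>J. z j ^ \<alpha> j)))"
        unfolding q_def sum_distrib_right by (intro sum.cong refl) auto
      also have "\<dots> = (\<Sum>\<alpha>\<in>A. c \<alpha> * (x ^ \<alpha> i * (\<Prod>j\<in>J. z j ^ \<alpha> j)))"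
        using N insert.prems(1) by (intro sum.group) auto
      also have "\<dots> = (\<Sum>\<alpha>\<in>A. c \<alpha> * (\<Prod>j\<in>insert i J. (z(i := x)) j ^ \<alpha> j))"
      proof (intro sum.cong refl arg_cong2[where f = "(*)"])
        fix \<alpha>
        have "(\<Prod>j\<in>J. (z(i := x)) j ^ \<alpha> j) = (\<Prod>j\<in>J. z j ^ \<alpha> j)"
          using insert.hyps by (intro prod.cong) auto
        then show "x ^ \<alpha> i * (\<Prod>j\<in>J. z j ^ \<alpha> j) = (\<Prod>j\<in>insert i J. (z(i := x)) j ^ \<alpha> j)"
          using insert.hyps by simp
      qed
      also have "\<dots> = 0" by (rule insert.prems(3))
      finally show ?thesis .
    qed
    then have "q (\<gamma> i) = 0"
      using polyfun_eq_0[of q N] N[OF insert.prems(4)] by blast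
    then show ?thesis by (simp add: q_def)
  qed
  moreover have "\<alpha> = \<beta>" if "\<alpha> \<in> {\<alpha> \<in> A. \<alpha> i = \<gamma> i}" "\<beta> \<in> {\<alpha> \<in> A. \<alpha> i = \<gamma> i}"
    "\<And>j. j \<in> J \<Longrightarrow> \<alpha> j = \<beta> j" for \<alpha> \<beta>
  proof (rule insert.prems(2))
    show "\<alpha> j = \<beta> j" if "j \<in> insert i J" for j
      using that \<open>\<And>j. j \<in> J \<Longrightarrow> \<alpha> j = \<beta> j\<close> \<open>\<alpha> \<in> _\<close> \<open>\<beta> \<in> _\<close> by auto
  qed (use that in auto)
  ultimately show ?case
    using insert.prems(1,4) by (intro insert.IH[of "{\<alpha> \<in> A. \<alpha> i = \<gamma> i}"]) auto
qed

section \<open>Power series that vanish on the ball\<close>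

lemma mpow_scale: "mpow (\<chi> j. t * z $ j) \<alpha> = t ^ mabs \<alpha> * mpow z \<alpha>"
  by (simp add: mpow_def mabs_def power_mult_distrib prod.distrib power_sum)

text \<open>On the complex line through \<open>z\<close> the homogeneous part of degree
  \<open>n\<close> becomes the coefficient of \<open>t ^ n\<close>, so one-variable uniqueness kills
  it, first on the ball and then, by homogeneity, everywhere. \<open>polynomial_eq_0\<close>
  separates the exponents within one degree.\<close>

lemma power_series_eq_0:
  fixes c :: "('d::finite \<Rightarrow> nat) \<Rightarrow> complex"
  assumes a: "a > 0" and c: "\<And>\<alpha>. cmod (c \<alpha>) \<le> C * sqrt (ratio a m \<alpha>)"
    and zero: "\<And>z. norm z < 1 \<Longrightarrow> infsum (\<lambda>\<alpha>. c \<alpha> * mpow z \<alpha>) UNIV = 0"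
  shows "c \<gamma> = 0"
proof -
  define f where "f n z = (\<Sum>\<alpha>\<in>hom_idx n. c \<alpha> * mpow z \<alpha>)" for n and z :: "complex ^ 'd"
  have scale: "f n (\<chi> j. t * z $ j) = f n z * t ^ n" for n t z
    unfolding f_def sum_distrib_right
    by (intro sum.cong refl) (simp add: mpow_scale hom_idx_def)
  have norm_scale: "norm (\<chi> j. t * z $ j) = cmod t * norm z" for t and z :: "complex ^ 'd"
    by (simp add: norm_vec_def norm_mult L2_set_right_distrib)
  have ball: "f n z = 0" if z: "norm z < 1" for n z
  proof -
    have s: "(\<lambda>n. f n z * t ^ n) sums 0" if t: "cmod t < 1" for t
    proof -
      have nz: "norm (\<chi> j. t * z $ j) < 1"
        unfolding norm_scale using mult_right_mono[of "cmod t" 1 "norm z"] t z by simp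
      have "(\<lambda>n. f n (\<chi> j. t * z $ j)) sums infsum (\<lambda>\<alpha>. c \<alpha> * mpow (\<chi> j. t * z $ j) \<alpha>) UNIV"
        unfolding f_def by (intro homogeneous_sums summable_power_series[OF a nz c])
      then show ?thesis using zero[OF nz] by (simp add: scale)
    qed
    define F where "F = Abs_fps (\<lambda>n. f n z)"
    have "fps_conv_radius F \<ge> norm (1/2 :: complex)"
      unfolding fps_conv_radius_def F_def fps_nth_Abs_fps using s[of "1/2"]
      by (intro conv_radius_geI sums_summable) auto
    then have r: "fps_conv_radius F > 0"
      by (rule less_le_trans[rotated]) simp
    have "\<forall>\<^sub>F t in nhds 0. t \<in> ball (0::complex) 1"
      by (rule eventually_nhds_in_open) auto
    then have "\<forall>\<^sub>F t in nhds 0. eval_fps F t = eval_fps 0 t"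
      by (rule eventually_mono) (use s sums_unique in \<open>fastforce simp: eval_fps_def F_def\<close>)
    then have "F = 0" using r by (intro eval_fps_eqD) auto
    then show ?thesis by (metis F_def fps_nth_Abs_fps fps_zero_nth)
  qed
  have all: "f n z = 0" for n z
  proof -
    define t where "t = complex_of_real (1 / (norm z + 1))"
    have "0 < norm z + 1" by (simp add: add_nonneg_pos)
    then have "t \<noteq> 0" "norm (\<chi> j. t * z $ j) < 1"
      unfolding norm_scale t_def norm_of_real by (auto simp del: of_real_divide)
    then show ?thesis using ball[of "\<chi> j. t * z $ j" n] by (simp add: scale)
  qed
  show ?thesis
  proof (rule polynomial_eq_0[of UNIV "hom_idx (mabs \<gamma>)"])
    fix z :: "'d \<Rightarrow> complex"
    show "(\<Sum>\<alpha>\<in>hom_idx (mabs \<gamma>). c \<alpha> * (\<Prod>j\<in>UNIV. z j ^ \<alpha> j)) = 0"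
      using all[of "mabs \<gamma>" "\<chi> j. z j"] by (simp add: f_def mpow_def)
  qed (auto simp: finite_hom_idx, auto simp: hom_idx_def)
qed

section \<open>Sums over fibres and projections in \<open>l2\<close>\<close>

lemma sum_infsum_swap:
  fixes F :: "'x \<Rightarrow> 'y \<Rightarrow> complex"
  assumes "finite A" "\<And>x. x \<in> A \<Longrightarrow> F x summable_on B"
  shows "(\<Sum>x\<in>A. infsum (F x) B) = infsum (\<lambda>y. \<Sum>x\<in>A. F x y) B"
proof -
  have "((\<lambda>y. \<Sum>x\<in>A. F x y) has_sum (\<Sum>x\<in>A. infsum (F x) B)) B"
    using assms by (induction A rule: finite_induct) (auto intro!: has_sum_add)
  then show ?thesis by (rule infsumI[symmetric])
qed

text \<open>With finite fibres and nonnegative terms, grouping loses nothing in either direction. It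
  is applied to vertices and to pairs of an exponent and a vertex, grouped by the same level
  \<beta>, so that finite Parseval identities pass to \<open>l2\<close>.\<close>

lemma summable_on_fibres:
  fixes F :: "'x \<Rightarrow> real" and k :: "'x \<Rightarrow> 'k"
  assumes fin: "\<And>b. finite {x \<in> X. k x = b}" and nonneg: "\<And>x. F x \<ge> 0"
  shows "F summable_on X \<longleftrightarrow> (\<lambda>b. \<Sum>x\<in>{x \<in> X. k x = b}. F x) summable_on UNIV"
proof -
  have bij: "bij_betw snd (Sigma UNIV (\<lambda>b. {x \<in> X. k x = b})) X"
    by (rule bij_betwI[where g = "\<lambda>x. (k x, x)"]) auto
  have "F summable_on X \<longleftrightarrow> (\<lambda>p. F (snd p)) summable_on Sigma UNIV (\<lambda>b. {x \<in> X. k x = b})"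
    by (rule summable_on_reindex_bij_betw[OF bij, symmetric])
  also have "\<dots> \<longleftrightarrow> (\<lambda>b. \<Sum>x\<in>{x \<in> X. k x = b}. F x) summable_on UNIV"
  proof
    assume "(\<lambda>p. F (snd p)) summable_on Sigma UNIV (\<lambda>b. {x \<in> X. k x = b})"
    then have "(\<lambda>b. infsum (\<lambda>x. F (snd (b, x))) {x \<in> X. k x = b}) summable_on UNIV"
      by (rule summable_on_SigmaD) (simp add: fin)
    then show "(\<lambda>b. \<Sum>x\<in>{x \<in> X. k x = b}. F x) summable_on UNIV" using fin by simp
  next
    assume "(\<lambda>b. \<Sum>x\<in>{x \<in> X. k x = b}. F x) summable_on UNIV"
    then show "(\<lambda>p. F (snd p)) summable_on Sigma UNIV (\<lambda>b. {x \<in> X. k x = b})"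
      by (rule summable_on_SigmaI[rotated]) (use fin nonneg in auto)
  qed
  finally show ?thesis .
qed

lemma has_sum_fibres:
  fixes F :: "'x \<Rightarrow> complex" and k :: "'x \<Rightarrow> 'k"
  assumes fin: "\<And>b. finite {x \<in> X. k x = b}" and "F summable_on X"
  shows "((\<lambda>b. \<Sum>x\<in>{x \<in> X. k x = b}. F x) has_sum infsum F X) UNIV"
proof -
  have bij: "bij_betw snd (Sigma UNIV (\<lambda>b. {x \<in> X. k x = b})) X"
    by (rule bij_betwI[where g = "\<lambda>x. (k x, x)"]) auto
  have "(F has_sum infsum F X) X" using assms by simp
  then have "((\<lambda>p. F (snd p)) has_sum infsum F X) (Sigma UNIV (\<lambda>b. {x \<in> X. k x = b}))"
    by (subst has_sum_reindex_bij_betw[OF bij])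
  then show ?thesis by (rule has_sum_SigmaD) (simp add: fin)
qed

lemma summable_mult_cnj:
  fixes f g :: "'x \<Rightarrow> complex"
  assumes "(\<lambda>x. (cmod (f x))\<^sup>2) summable_on X" "(\<lambda>x. (cmod (g x))\<^sup>2) summable_on X"
  shows "(\<lambda>x. f x * cnj (g x)) summable_on X"
proof (rule abs_summable_summable, rule summable_on_comparison_test)
  show "(\<lambda>x. (cmod (f x))\<^sup>2 + (cmod (g x))\<^sup>2) summable_on X"
    using assms by (rule summable_on_add)
  fix x
  have "2 * (cmod (f x) * cmod (g x)) \<le> (cmod (f x))\<^sup>2 + (cmod (g x))\<^sup>2"
    using sum_squares_bound[of "cmod (f x)" "cmod (g x)"] by simp
  moreover have "0 \<le> cmod (f x) * cmod (g x)" by simp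
  ultimately have "cmod (f x) * cmod (g x) \<le> (cmod (f x))\<^sup>2 + (cmod (g x))\<^sup>2" by linarith
  then show "norm (f x * cnj (g x)) \<le> (cmod (f x))\<^sup>2 + (cmod (g x))\<^sup>2"
    by (simp add: norm_mult)
qed simp

lemma infsum_finite_support:
  assumes "finite S" "S \<subseteq> X" "\<And>x. x \<in> X - S \<Longrightarrow> f x = 0"
  shows "infsum f X = sum f S"
proof -
  have "infsum f X = infsum f S"
    by (rule infsum_cong_neutral) (use assms in auto)
  then show ?thesis using assms by simp
qed

lemma l2_finite_support:
  assumes "finite S" "S \<subseteq> X" "\<And>x. x \<notin> S \<Longrightarrow> f x = 0"
  shows "f \<in> l2 X"
proof -
  have "(\<lambda>x. (cmod (f x))\<^sup>2) summable_on X \<longleftrightarrow> (\<lambda>x. (cmod (f x))\<^sup>2) summable_on S"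
    by (rule summable_on_cong_neutral) (use assms in auto)
  then show ?thesis using assms by (auto simp: l2_def)
qed

text \<open>The cut-off \<open>p\<close> of \<open>e\<close> qualifies because \<open>e - p\<close>
  vanishes on \<open>S\<close>, which carries all of \<open>M\<close>. For another candidate
  \<open>q\<close>, the difference \<open>p - q\<close> lies in \<open>M\<close> and is orthogonal
  to itself, hence zero.\<close>

lemma orth_proj_restriction:
  assumes S: "finite S" "S \<subseteq> X"
    and supp: "\<And>m x. m \<in> M \<Longrightarrow> x \<notin> S \<Longrightarrow> m x = 0"
    and diff: "\<And>m m'. m \<in> M \<Longrightarrow> m' \<in> M \<Longrightarrow> (\<lambda>x. m x - m' x) \<in> M"
    and restr: "(\<lambda>x. if x \<in> S then e x else 0) \<in> M"
  shows "orth_proj X M e = (\<lambda>x. if x \<in> S then e x else 0)"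
proof -
  define p where "p = (\<lambda>x. if x \<in> S then e x else 0)"
  have inner: "l2_inner X f m = (\<Sum>x\<in>S. f x * cnj (m x))" if "m \<in> M" for f m
    unfolding l2_inner_def by (rule infsum_finite_support) (use S supp that in auto)
  show ?thesis
    unfolding orth_proj_def p_def[symmetric]
  proof (rule the_equality)
    show "p \<in> M \<and> (\<forall>m\<in>M. l2_inner X (\<lambda>x. e x - p x) m = 0)"
      using restr inner by (auto simp: p_def)
  next
    fix q assume q: "q \<in> M \<and> (\<forall>m\<in>M. l2_inner X (\<lambda>x. e x - q x) m = 0)"
    define m where "m = (\<lambda>x. p x - q x)"
    have m: "m \<in> M" unfolding m_def using q restr diff by (simp add: p_def)
    have "(\<Sum>x\<in>S. (e x - q x) * cnj (m x)) = 0"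
      using q m inner by metis
    moreover have "(\<Sum>x\<in>S. (e x - q x) * cnj (m x)) = complex_of_real (\<Sum>x\<in>S. (cmod (m x))\<^sup>2)"
      unfolding of_real_sum
      by (rule sum.cong) (auto simp: m_def p_def complex_norm_square simp del: of_real_power)
    ultimately have "(\<Sum>x\<in>S. (cmod (m x))\<^sup>2) = 0"
      by (metis of_real_eq_0_iff)
    then have "\<forall>x\<in>S. m x = 0"
      using S by (subst (asm) sum_nonneg_eq_0_iff) auto
    then have "m x = 0" for x
      using supp[OF m] by blast
    then show "q = p" by (auto simp: m_def fun_eq_iff)
  qed
qed

lemma holo_scalar_cong:
  assumes "holo_scalar S f" "open S" "\<And>z. z \<in> S \<Longrightarrow> f z = g z"
  shows "holo_scalar S g"
  unfolding holo_scalar_def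
proof
  fix z assume z: "z \<in> S"
  then obtain c where "(f has_derivative (\<lambda>h. \<Sum>j\<in>UNIV. c $ j * h $ j)) (at z)"
    using assms(1) unfolding holo_scalar_def by blast
  then have "(g has_derivative (\<lambda>h. \<Sum>j\<in>UNIV. c $ j * h $ j)) (at z)"
    by (rule has_derivative_transform_within_open[OF _ assms(2) z assms(3)])
  then show "\<exists>c :: complex ^ 'a. (g has_derivative (\<lambda>h. \<Sum>j\<in>UNIV. c $ j * h $ j)) (at z)" by blast
qed

lemma holo_scalar_linear_combination:
  fixes f :: "'x \<Rightarrow> complex ^ 'd::finite \<Rightarrow> complex"
  assumes "\<And>x. x \<in> A \<Longrightarrow> holo_scalar S (f x)"
  shows "holo_scalar S (\<lambda>z. \<Sum>x\<in>A. f x z * b x)"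
  unfolding holo_scalar_def
proof
  fix z assume z: "z \<in> S"
  then have "\<forall>x\<in>A. \<exists>c :: complex ^ 'd. (f x has_derivative (\<lambda>h. \<Sum>j\<in>UNIV. c $ j * h $ j)) (at z)"
    using assms unfolding holo_scalar_def by blast
  then obtain c :: "'x \<Rightarrow> complex ^ 'd"
    where c: "\<And>x. x \<in> A \<Longrightarrow> (f x has_derivative (\<lambda>h. \<Sum>j\<in>UNIV. c x $ j * h $ j)) (at z)"
    by metis
  define d :: "complex ^ 'd" where "d = (\<chi> j. \<Sum>x\<in>A. c x $ j * b x)"
  have "((\<lambda>z. \<Sum>x\<in>A. f x z * b x) has_derivative (\<lambda>h. \<Sum>x\<in>A. (\<Sum>j\<in>UNIV. c x $ j * h $ j) * b x)) (at z)"
    by (intro has_derivative_sum has_derivative_mult_left c)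
  moreover have "(\<Sum>x\<in>A. (\<Sum>j\<in>UNIV. c x $ j * h $ j) * b x) = (\<Sum>j\<in>UNIV. d $ j * h $ j)" for h
    unfolding d_def vec_lambda_beta sum_distrib_right by (subst sum.swap) (simp add: mult_ac)
  ultimately show "\<exists>d :: complex ^ 'd. ((\<lambda>z. \<Sum>x\<in>A. f x z * b x) has_derivative
      (\<lambda>h. \<Sum>j\<in>UNIV. d $ j * h $ j)) (at z)"
    by auto
qed

section \<open>Wold decomposition on a single tree\<close>

locale leafless_tree =
  fixes V :: "'a set" and E :: "('a \<times> 'a) set" and r :: 'a
  assumes rooted: "rooted_tree V E r"
    and locally_fin: "locally_finite V E"
    and leafless: "leafless V E"
begin

section \<open>Parents, depths and finite levels of a tree\<close>

abbreviation "chi \<equiv> children E"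
abbreviation "par \<equiv> parent E"
abbreviation "dep \<equiv> depth E r"

definition lev :: "nat \<Rightarrow> 'a set" where
  "lev n = {v \<in> V. dep v = n}"

text \<open>For \<open>e\<close> in ker T* at depth \<open>dep x\<close>, the vector
  \<open>T^k e\<close> sits at depth \<open>k + dep x\<close>; these are the pairs that contribute
  to level \<open>n\<close>.\<close>

definition idx :: "nat \<Rightarrow> (nat \<times> 'a) set" where
  "idx n = {(k, x). x \<in> V \<and> k + dep x = n}"

lemma root_in: "r \<in> V" and no_edge_to_root: "(u, r) \<notin> E"
  using rooted by (auto simp: rooted_tree_def)

lemma edge_in: "(u, v) \<in> E \<Longrightarrow> u \<in> V \<and> v \<in> V"
  using rooted by (auto simp: rooted_tree_def directed_tree_def)

lemma edge_unique: "(u, v) \<in> E \<Longrightarrow> (u', v) \<in> E \<Longrightarrow> u = u'"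
  using rooted edge_in[of u v] unfolding rooted_tree_def directed_tree_def by blast

lemma parent_eq: "(u, v) \<in> E \<Longrightarrow> par v = u"
  unfolding parent_def using edge_unique by blast

lemma parent_edge: "v \<in> V \<Longrightarrow> v \<noteq> r \<Longrightarrow> (par v, v) \<in> E"
  using rooted parent_eq unfolding rooted_tree_def by metis

lemma parent_in: "v \<in> V \<Longrightarrow> v \<noteq> r \<Longrightarrow> par v \<in> V"
  using parent_edge edge_in by blast

lemma chi_iff: "v \<in> chi u \<longleftrightarrow> v \<in> V \<and> v \<noteq> r \<and> par v = u"
  unfolding children_def
  using parent_edge parent_eq edge_in no_edge_to_root by blast

lemma finite_chi: "u \<in> V \<Longrightarrow> finite (chi u)"
  using locally_fin by (auto simp: locally_finite_def)

lemma card_chi: "u \<in> V \<Longrightarrow> card (chi u) > 0"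
  using leafless finite_chi by (auto simp: leafless_def card_gt_0_iff)

text \<open>Induction along an undirected walk from the root. A step against an edge leads from
  \<open>y\<close> to its parent, which is the last but one vertex of the directed path already
  found, because parents are unique.\<close>

lemma reachable:
  assumes "v \<in> V" shows "(r, v) \<in> E\<^sup>*"
proof -
  have "(r, v) \<in> (E \<union> E\<inverse>)\<^sup>*"
    using rooted root_in assms unfolding rooted_tree_def directed_tree_def by blast
  then show ?thesis
  proof induction
    case base
    show ?case by simp
  next
    case (step y z)
    show ?case
    proof (cases "(y, z) \<in> E")
      case True
      with step show ?thesis by auto
    next
      case False
      then have zy: "(z, y) \<in> E" using step by auto
      then have "y \<noteq> r" using no_edge_to_root by auto
      then obtain u where "(r, u) \<in> E\<^sup>*" "(u, y) \<in> E"
        using step(3) by (metis rtranclE)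
      then show ?thesis using edge_unique zy by blast
    qed
  qed
qed

text \<open>Paths are retraced from the far end, where the last edge is forced, and no edge enters
  the root. This makes the description in \<open>depth\<close> definite.\<close>

lemma relpow_unique: "(r, v) \<in> E ^^ n \<Longrightarrow> (r, v) \<in> E ^^ m \<Longrightarrow> n = m"
proof (induction n arbitrary: v m)
  case 0
  then show ?case using no_edge_to_root by (cases m) auto
next
  case (Suc n)
  then obtain u where u: "(r, u) \<in> E ^^ n" "(u, v) \<in> E" by auto
  show ?case
  proof (cases m)
    case 0
    with Suc.prems u no_edge_to_root show ?thesis by auto
  next
    case (Suc m')
    with Suc.prems obtain u' where u': "(r, u') \<in> E ^^ m'" "(u', v) \<in> E" by auto
    have "u' = u" using u u' edge_unique by blast
    then show ?thesis using Suc.IH[OF u(1), of m'] u' Suc by simp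
  qed
qed

lemma depth_eqI: "(r, v) \<in> E ^^ n \<Longrightarrow> dep v = n"
  unfolding depth_def using relpow_unique by blast

lemma depth_relpow: "v \<in> V \<Longrightarrow> (r, v) \<in> E ^^ dep v"
  using reachable[of v] depth_eqI by (auto simp: rtrancl_power)

lemma depth_root [simp]: "dep r = 0"
  by (rule depth_eqI) simp

lemma depth_parent: "v \<in> V \<Longrightarrow> v \<noteq> r \<Longrightarrow> dep v = Suc (dep (par v))"
  by (rule depth_eqI) (use depth_relpow[OF parent_in] parent_edge in auto)

lemma depth_chi: "w \<in> chi v \<Longrightarrow> dep w = Suc (dep v)"
  using chi_iff depth_parent by auto

lemma depth_0_iff: "v \<in> V \<Longrightarrow> dep v = 0 \<longleftrightarrow> v = r"
  using depth_parent by fastforce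

lemma lev_0: "lev 0 = {r}"
  unfolding lev_def using depth_0_iff root_in by auto

lemma lev_Suc: "lev (Suc n) = (\<Union>v\<in>lev n. chi v)"
proof (intro set_eqI iffI)
  fix y assume "y \<in> lev (Suc n)"
  then have y: "y \<in> V" "dep y = Suc n" by (auto simp: lev_def)
  then have nr: "y \<noteq> r" by auto
  have "par y \<in> lev n"
    using y nr depth_parent[of y] parent_in[of y] by (auto simp: lev_def)
  moreover have "y \<in> chi (par y)" using y nr chi_iff by simp
  ultimately show "y \<in> (\<Union>v\<in>lev n. chi v)" by blast
next
  fix y assume "y \<in> (\<Union>v\<in>lev n. chi v)"
  then show "y \<in> lev (Suc n)" using depth_chi chi_iff by (auto simp: lev_def)
qed

lemma lev_in: "v \<in> lev n \<Longrightarrow> v \<in> V"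
  by (simp add: lev_def)

lemma finite_lev: "finite (lev n)"
  by (induction n) (auto simp: lev_0 lev_Suc lev_in finite_chi)

lemma sum_lev_Suc: "(\<Sum>y\<in>lev (Suc n). F y) = (\<Sum>v\<in>lev n. \<Sum>y\<in>chi v. F y)"
  unfolding lev_Suc
  by (rule sum.UNION_disjoint) (auto simp: finite_lev finite_chi lev_in chi_iff)

lemma idx_0: "idx 0 = {(0, r)}"
  unfolding idx_def using depth_0_iff root_in by auto

text \<open>Level \<open>Suc n\<close> receives new vectors of ker T*, with \<open>k = 0\<close>;
  everything else is level \<open>n\<close> moved by one shift.\<close>

lemma idx_Suc: "idx (Suc n) = Pair 0 ` lev (Suc n) \<union> apfst Suc ` idx n"
proof (intro set_eqI)
  fix q :: "nat \<times> 'a"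
  obtain k x where q: "q = (k, x)" by (cases q)
  show "q \<in> idx (Suc n) \<longleftrightarrow> q \<in> Pair 0 ` lev (Suc n) \<union> apfst Suc ` idx n"
    unfolding q by (cases k) (auto simp: idx_def lev_def image_iff)
qed

lemma finite_idx: "finite (idx n)"
  by (induction n) (simp_all add: idx_0 idx_Suc finite_lev)

lemma sum_idx_Suc:
  "(\<Sum>q\<in>idx (Suc n). F q) = (\<Sum>x\<in>lev (Suc n). F (0, x)) + (\<Sum>(k, x)\<in>idx n. F (Suc k, x))"
proof -
  have "inj_on (apfst Suc) (idx n)" by (auto simp: inj_on_def)
  moreover have "inj_on (Pair (0::nat)) (lev (Suc n))" by (auto simp: inj_on_def)
  moreover have "Pair 0 ` lev (Suc n) \<inter> apfst Suc ` idx n = {}" by auto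
  ultimately show ?thesis
    unfolding idx_Suc
    by (subst sum.union_disjoint)
      (auto simp: finite_lev finite_idx sum.reindex case_prod_unfold apfst_def map_prod_def)
qed

text \<open>Let \<open>T\<close> be the isometric shift with weights \<open>1 / sqrt (card (chi (par y)))\<close>. Then \<open>wproj\<close> is the matrix
  of \<open>P = I - T T*\<close>, the projection onto \<open>ker T*\<close>, and \<open>wmat k\<close> is the matrix of \<open>P (T*)^k\<close>.\<close>
definition wproj :: "'a \<Rightarrow> 'a \<Rightarrow> real" where
  "wproj x y = of_bool (x = y) - (if x \<noteq> r \<and> y \<noteq> r \<and> par x = par y then 1 / card (chi (par y)) else 0)"

primrec wmat :: "nat \<Rightarrow> 'a \<Rightarrow> 'a \<Rightarrow> real" where
  "wmat 0 x y = wproj x y"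
| "wmat (Suc k) x y = (if y = r then 0 else wmat k x (par y) / sqrt (card (chi (par y))))"

section \<open>Algebra of the Wold matrices of one tree\<close>

lemma wproj_sym: "wproj x y = wproj y x"
  by (auto simp: wproj_def)

text \<open>Up to a factor, T* sums over the children of a vertex, so this is
  \<open>T* P = 0\<close>. Within one sibling set the diagonal entry 1 is offset by
  \<open>card\<close> entries of size 1 / card.\<close>

lemma wproj_chi_sum:
  assumes "v \<in> V" "y \<in> V"
  shows "(\<Sum>w\<in>chi v. wproj w y) = 0"
proof (cases "y \<in> chi v")
  case True
  then have "wproj w y = of_bool (w = y) - 1 / card (chi v)" if "w \<in> chi v" for w
    using that chi_iff by (auto simp: wproj_def)
  then have "(\<Sum>w\<in>chi v. wproj w y) = (\<Sum>w\<in>chi v. of_bool (w = y)) - (\<Sum>w\<in>chi v. 1 / card (chi v))"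
    by (simp add: sum_subtractf)
  also have "(\<Sum>w\<in>chi v. of_bool (w = y)) = (1::real)"
    using True finite_chi[OF assms(1)] by (simp add: of_bool_def sum.delta)
  also have "(\<Sum>w\<in>chi v. 1 / card (chi v)) = (1::real)"
    using card_chi[OF assms(1)] by simp
  finally show ?thesis by simp
next
  case False
  then have "wproj w y = 0" if "w \<in> chi v" for w
    using that assms chi_iff by (auto simp: wproj_def)
  then show ?thesis by simp
qed

lemma wproj_chi_sum': "v \<in> V \<Longrightarrow> x \<in> V \<Longrightarrow> (\<Sum>w\<in>chi v. wproj x w) = 0"
  by (subst sum.cong[OF refl wproj_sym]) (rule wproj_chi_sum)

lemma chi_subset_lev: "v \<in> V \<Longrightarrow> w \<in> chi v \<Longrightarrow> chi v \<subseteq> lev (dep w)"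
  using depth_chi chi_iff by (auto simp: lev_def)

text \<open>\<open>P\<close> is a symmetric idempotent. In the first factor the identity part
  reproduces \<open>wproj y y'\<close>, while the averaging part \<open>s\<close> is constant on a
  sibling set, over which the second factor sums to 0.\<close>

lemma wproj_mult:
  assumes "y \<in> lev n" "y' \<in> V"
  shows "(\<Sum>x\<in>lev n. wproj x y * wproj x y') = wproj y y'"
proof -
  define s where "s x = (if x \<noteq> r \<and> y \<noteq> r \<and> par x = par y then 1 / real (card (chi (par y))) else 0)" for x
  have "(\<Sum>x\<in>lev n. wproj x y * wproj x y')
      = (\<Sum>x\<in>lev n. of_bool (x = y) * wproj x y') - (\<Sum>x\<in>lev n. s x * wproj x y')"
    unfolding sum_subtractf[symmetric] by (rule sum.cong) (auto simp: wproj_def s_def algebra_simps)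
  also have "(\<Sum>x\<in>lev n. of_bool (x = y) * wproj x y') = wproj y y'"
    using assms finite_lev[of n] by (simp add: of_bool_def if_distrib[of "\<lambda>c. c * _"] sum.delta cong: if_cong)
  also have "(\<Sum>x\<in>lev n. s x * wproj x y') = 0"
  proof (cases "y = r")
    case True
    then show ?thesis by (simp add: s_def)
  next
    case False
    have y: "y \<in> V" "dep y = n" using assms by (auto simp: lev_def)
    then have p: "par y \<in> V" "y \<in> chi (par y)" using False parent_in chi_iff by auto
    have "(\<Sum>x\<in>lev n. s x * wproj x y') = (\<Sum>x\<in>chi (par y). s x * wproj x y')"
      using chi_subset_lev[OF p] y finite_lev
      by (intro sum.mono_neutral_right) (auto simp: s_def chi_iff lev_def)
    also have "\<dots> = (\<Sum>x\<in>chi (par y). 1 / real (card (chi (par y))) * wproj x y')"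
      by (rule sum.cong) (use False chi_iff in \<open>auto simp: s_def\<close>)
    also have "\<dots> = 0"
      unfolding sum_distrib_left[symmetric] using wproj_chi_sum p assms by simp
    finally show ?thesis .
  qed
  finally show ?thesis by simp
qed

text \<open>The part \<open>T T*\<close> subtracted from the identity sees a vertex only through its
  parent. This lets a coordinate projection be exchanged for the identity when pairing with a
  balanced function.\<close>

lemma wproj_offdiag:
  assumes "w \<in> chi u" "w' \<in> chi u"
  shows "wproj x w - of_bool (x = w) = wproj x w' - of_bool (x = w')"
  using assms by (auto simp: wproj_def chi_iff)

lemma wproj_root: "x = r \<or> y = r \<Longrightarrow> wproj x y = of_bool (x = y)"
  by (auto simp: wproj_def)

text \<open>Right multiplication by \<open>T\<close> is summation over \<open>chi v\<close> divided
  by \<open>sqrt (card (chi v))\<close>, so this reads \<open>P T = 0\<close> and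
  \<open>P T*^(l+1) T = P T*^l\<close>.\<close>

lemma wmat_chi_sum_right:
  assumes "v \<in> V" "x \<in> V"
  shows "(\<Sum>w\<in>chi v. wmat k x w) = (case k of 0 \<Rightarrow> 0 | Suc l \<Rightarrow> sqrt (card (chi v)) * wmat l x v)"
proof (cases k)
  case 0
  then show ?thesis using wproj_chi_sum' assms by simp
next
  case (Suc l)
  have "(\<Sum>w\<in>chi v. wmat k x w) = (\<Sum>w\<in>chi v. wmat l x v / sqrt (card (chi v)))"
    by (rule sum.cong) (use Suc in \<open>auto simp: chi_iff\<close>)
  also have "\<dots> = card (chi v) / sqrt (card (chi v)) * wmat l x v"
    by simp
  also have "\<dots> = sqrt (card (chi v)) * wmat l x v"
    by (subst real_div_sqrt) auto
  finally show ?thesis using Suc by simp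
qed

text \<open>Inductively the sum of \<open>T^k P T*^k\<close> is \<open>P + T I T*\<close>, which is
  \<open>I\<close> by the definition of \<open>P\<close>; on one level the sum is finite.\<close>

lemma wmat_complete:
  "y \<in> lev n \<Longrightarrow> y' \<in> lev n \<Longrightarrow> (\<Sum>(k, x)\<in>idx n. wmat k x y * wmat k x y') = of_bool (y = y')"
proof (induction n arbitrary: y y')
  case 0
  then show ?case by (simp add: idx_0 lev_0 wproj_def)
next
  case (Suc n)
  have y: "y \<in> V" "y \<noteq> r" "y' \<in> V" "y' \<noteq> r" using Suc.prems by (auto simp: lev_def)
  have p: "par y \<in> lev n" "par y' \<in> lev n"
    using Suc.prems y depth_parent parent_in by (auto simp: lev_def)
  have "(\<Sum>(k, x)\<in>idx (Suc n). wmat k x y * wmat k x y')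
     = (\<Sum>x\<in>lev (Suc n). wproj x y * wproj x y') + (\<Sum>(k, x)\<in>idx n. wmat (Suc k) x y * wmat (Suc k) x y')"
    unfolding sum_idx_Suc by simp
  also have "(\<Sum>x\<in>lev (Suc n). wproj x y * wproj x y') = wproj y y'"
    using wproj_mult Suc.prems y by simp
  also have "(\<Sum>(k, x)\<in>idx n. wmat (Suc k) x y * wmat (Suc k) x y')
     = (\<Sum>(k, x)\<in>idx n. wmat k x (par y) * wmat k x (par y')) / (sqrt (card (chi (par y))) * sqrt (card (chi (par y'))))"
    unfolding sum_divide_distrib by (rule sum.cong) (use y in auto)
  also have "\<dots> = of_bool (par y = par y') / (sqrt (card (chi (par y))) * sqrt (card (chi (par y'))))"
    using Suc.IH p by simp
  also have "wproj y y' + \<dots> = of_bool (y = y')"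
    using y by (auto simp: wproj_def)
  finally show ?case .
qed

lemma wmat_chi_sum_left: "v \<in> V \<Longrightarrow> y \<in> V \<Longrightarrow> (\<Sum>w\<in>chi v. wmat k w y) = 0"
proof (induction k arbitrary: y)
  case 0
  then show ?case using wproj_chi_sum by simp
next
  case (Suc k)
  then show ?case using parent_in[of y] by (cases "y = r") (auto simp: sum_divide_distrib[symmetric])
qed

text \<open>In \<open>P T*^k T^k' P\<close> the relation \<open>T* T = I\<close> leaves a power of
  \<open>T\<close> or of \<open>T*\<close> next to \<open>P\<close>, which \<open>P T = 0\<close>
  kills unless \<open>k = k'\<close>; then \<open>P P = P\<close> remains.\<close>

lemma wmat_orthogonal:
  assumes "(k, x) \<in> idx n" "(k', x') \<in> idx n"
  shows "(\<Sum>y\<in>lev n. wmat k x y * wmat k' x' y) = (if k = k' then wproj x x' else 0)"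
  using assms
proof (induction n arbitrary: k k')
  case 0
  then show ?case by (simp add: idx_0 lev_0 wproj_def)
next
  case (Suc n)
  have V: "x \<in> V" "x' \<in> V" using Suc.prems by (auto simp: idx_def)
  \<comment> \<open>As a function of \<open>y\<close>, \<open>wmat (Suc l) s\<close> is constant on
    sibling sets, and \<open>wproj t\<close> sums to 0 over them.\<close>
  have mixed: "(\<Sum>y\<in>lev (Suc n). wproj t y * wmat (Suc l) s y) = 0" if "t \<in> V" "s \<in> V" for t s l
  proof -
    have "(\<Sum>y\<in>lev (Suc n). wproj t y * wmat (Suc l) s y)
        = (\<Sum>v\<in>lev n. \<Sum>y\<in>chi v. wproj t y * (wmat l s v / sqrt (card (chi v))))"
      unfolding sum_lev_Suc by (intro sum.cong) (auto simp: chi_iff)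
    also have "\<dots> = 0"
      unfolding sum_distrib_right[symmetric] using that wproj_chi_sum'
      by (intro sum.neutral) (auto simp: lev_def)
    finally show ?thesis .
  qed
  show ?case
  proof (cases k)
    case k0: 0
    show ?thesis
    proof (cases k')
      case 0
      have "(\<Sum>y\<in>lev (Suc n). wproj x y * wproj x' y) = (\<Sum>y\<in>lev (Suc n). wproj y x * wproj y x')"
        by (rule sum.cong) (metis wproj_sym)+
      also have "\<dots> = wproj x x'"
        using Suc.prems k0 V by (intro wproj_mult) (auto simp: idx_def lev_def)
      finally have "(\<Sum>y\<in>lev (Suc n). wproj x y * wproj x' y) = wproj x x'" .
      with 0 k0 show ?thesis by simp
    next
      case (Suc l)
      then show ?thesis using mixed V k0 by simp
    qed
  next
    case kS: (Suc l)
    show ?thesis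
    proof (cases k')
      case 0
      then show ?thesis using mixed[of x' x l] V kS by (simp add: mult.commute)
    next
      case k'S: (Suc l')
      have "(\<Sum>y\<in>lev (Suc n). wmat (Suc l) x y * wmat (Suc l') x' y)
        = (\<Sum>v\<in>lev n. \<Sum>y\<in>chi v. wmat l x v * wmat l' x' v / card (chi v))"
        unfolding sum_lev_Suc by (intro sum.cong) (auto simp: chi_iff)
      also have "\<dots> = (\<Sum>v\<in>lev n. wmat l x v * wmat l' x' v)"
        using card_chi by (intro sum.cong) (auto simp: lev_def)
      also have "\<dots> = (if l = l' then wproj x x' else 0)"
        using Suc.IH[of l l'] Suc.prems kS k'S by (simp add: idx_def)
      finally show ?thesis using kS k'S by simp
    qed
  qed
qed

text \<open>These vertices carry ker T*, since at an only child the sibling sum is the value itself.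
  Only finitely many depths branch, and levels are finite.\<close>

lemma finite_branching_children:
  assumes "finite_branching_index V E r"
  shows "finite {t \<in> V. t = r \<or> card (chi (par t)) \<ge> 2}"
proof -
  define D where "D = {dep w | w. w \<in> V \<and> card (chi w) \<ge> 2}"
  have "{t \<in> V. t = r \<or> card (chi (par t)) \<ge> 2} \<subseteq> {r} \<union> (\<Union>n\<in>D. lev (Suc n))"
  proof
    fix t assume t: "t \<in> {t \<in> V. t = r \<or> card (chi (par t)) \<ge> 2}"
    show "t \<in> {r} \<union> (\<Union>n\<in>D. lev (Suc n))"
    proof (cases "t = r")
      case False
      then have "dep (par t) \<in> D" "t \<in> lev (Suc (dep (par t)))"
        using t parent_in depth_parent by (auto simp: D_def lev_def)
      then show ?thesis by blast
    qed simp
  qed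
  moreover have "finite D" using assms by (simp add: D_def finite_branching_index_def)
  ultimately show ?thesis
    by (meson finite.emptyI finite.insertI finite_UN_I finite_UnI finite_lev finite_subset)
qed

end

section \<open>Products of trees\<close>

lemma prod_sum_dependent:
  fixes F :: "'d::finite \<Rightarrow> 'b \<Rightarrow> 'c::comm_semiring_1"
  assumes "\<And>j. finite (A j)"
  shows "(\<Prod>j\<in>UNIV. \<Sum>t\<in>A j. F j t) = (\<Sum>q\<in>{q. \<forall>j. q j \<in> A j}. \<Prod>j\<in>UNIV. F j (q j))"
proof -
  have "PiE UNIV A = {q. \<forall>j. q j \<in> A j}"
    by (auto simp: PiE_def)
  then show ?thesis
    using prod_sum_PiE[of UNIV A F] assms by simp
qed

lemma finite_dependent_functions:
  assumes "\<And>j. finite (A j)"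
  shows "finite {q :: 'd::finite \<Rightarrow> 'b. \<forall>j. q j \<in> A j}"
proof -
  have "PiE UNIV A = {q. \<forall>j. q j \<in> A j}"
    by (auto simp: PiE_def)
  then show ?thesis
    using finite_PiE[of UNIV A] assms by simp
qed

locale tree_product =
  fixes Vt :: "'d::finite \<Rightarrow> 'a set" and Et :: "'d \<Rightarrow> ('a \<times> 'a) set" and rt :: "'d \<Rightarrow> 'a"
    and a :: real
  assumes tree: "\<And>j. leafless_tree (Vt j) (Et j) (rt j)"
    and fin_branch: "\<And>j. finite_branching_index (Vt j) (Et j) (rt j)"
    and a_pos: "a > 0"
begin

section \<open>Levels and Wold matrices of the product\<close>

abbreviation "VV \<equiv> prodV Vt"
abbreviation "dp \<equiv> alpha Et rt"
abbreviation "chij \<equiv> chi_j Et"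
abbreviation "levj j \<equiv> leafless_tree.lev (Vt j) (Et j) (rt j)"
abbreviation "idxj j \<equiv> leafless_tree.idx (Vt j) (Et j) (rt j)"
abbreviation "wpj j \<equiv> leafless_tree.wproj (Et j) (rt j)"
abbreviation "wmj j \<equiv> leafless_tree.wmat (Et j) (rt j)"

definition plev :: "('d \<Rightarrow> nat) \<Rightarrow> ('d \<Rightarrow> 'a) set" where
  "plev \<beta> = {y \<in> VV. dp y = \<beta>}"

definition pidx :: "('d \<Rightarrow> nat) \<Rightarrow> (('d \<Rightarrow> nat) \<times> ('d \<Rightarrow> 'a)) set" where
  "pidx \<beta> = {(\<alpha>, x). x \<in> VV \<and> (\<lambda>j. \<alpha> j + dp x j) = \<beta>}"

text \<open>The tensor product of the matrices of the factors, that is the matrix of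
  \<open>P_1 ... P_d T*^\<alpha>\<close>: shifts, adjoints and projections of different directions
  commute, as they act on different coordinates.\<close>

definition pmat :: "('d \<Rightarrow> nat) \<Rightarrow> ('d \<Rightarrow> 'a) \<Rightarrow> ('d \<Rightarrow> 'a) \<Rightarrow> real" where
  "pmat \<alpha> x y = (\<Prod>j\<in>UNIV. wmj j (\<alpha> j) (x j) (y j))"

lemma plev_alt: "plev \<beta> = {y. \<forall>j. y j \<in> levj j (\<beta> j)}"
  by (auto simp: plev_def prodV_def alpha_def leafless_tree.lev_def[OF tree])

lemma plev_in: "y \<in> plev \<beta> \<Longrightarrow> y \<in> VV"
  by (simp add: plev_def)

lemma finite_plev: "finite (plev \<beta>)"
  unfolding plev_alt by (rule finite_dependent_functions) (rule leafless_tree.finite_lev[OF tree])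

text \<open>Trading pairs of functions for functions into pairs makes the index set a product over
  the coordinates, so that sums of products factor.\<close>

lemma sum_pidx:
  "(\<Sum>(\<alpha>, x)\<in>pidx \<beta>. F \<alpha> x) = (\<Sum>q\<in>{q. \<forall>j. q j \<in> idxj j (\<beta> j)}. F (\<lambda>j. fst (q j)) (\<lambda>j. snd (q j)))"
  by (rule sum.reindex_bij_witness[where j = "\<lambda>(\<alpha>, x) j. (\<alpha> j, x j)" and i = "\<lambda>q. (\<lambda>j. fst (q j), \<lambda>j. snd (q j))"])
    (auto simp: pidx_def leafless_tree.idx_def[OF tree] prodV_def alpha_def fun_eq_iff case_prod_unfold)

lemma finite_pidx: "finite (pidx \<beta>)"
proof -
  have "finite {q. \<forall>j. q j \<in> idxj j (\<beta> j)}"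
    by (rule finite_dependent_functions) (rule leafless_tree.finite_idx[OF tree])
  moreover have "pidx \<beta> \<subseteq> (\<lambda>q. (\<lambda>j. fst (q j), \<lambda>j. snd (q j))) ` {q. \<forall>j. q j \<in> idxj j (\<beta> j)}"
  proof
    fix p assume p: "p \<in> pidx \<beta>"
    obtain \<alpha> x where "p = (\<alpha>, x)" by (cases p)
    with p show "p \<in> (\<lambda>q. (\<lambda>j. fst (q j), \<lambda>j. snd (q j))) ` {q. \<forall>j. q j \<in> idxj j (\<beta> j)}"
      by (intro image_eqI[where x = "\<lambda>j. (\<alpha> j, x j)"])
        (auto simp: pidx_def leafless_tree.idx_def[OF tree] prodV_def alpha_def)
  qed
  ultimately show ?thesis by (rule finite_surj)
qed

lemma pmat_complete:
  assumes "y \<in> plev \<beta>" "y' \<in> plev \<beta>"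
  shows "(\<Sum>(\<alpha>, x)\<in>pidx \<beta>. pmat \<alpha> x y * pmat \<alpha> x y') = of_bool (y = y')"
proof -
  have "(\<Sum>(\<alpha>, x)\<in>pidx \<beta>. pmat \<alpha> x y * pmat \<alpha> x y')
      = (\<Sum>q\<in>{q. \<forall>j. q j \<in> idxj j (\<beta> j)}. \<Prod>j\<in>UNIV.
           (\<lambda>(k, t). wmj j k t (y j) * wmj j k t (y' j)) (q j))"
    unfolding sum_pidx pmat_def prod.distrib[symmetric] by (simp add: case_prod_unfold)
  also have "\<dots> = (\<Prod>j\<in>UNIV. \<Sum>(k, t)\<in>idxj j (\<beta> j). wmj j k t (y j) * wmj j k t (y' j))"
    by (rule prod_sum_dependent[symmetric]) (rule leafless_tree.finite_idx[OF tree])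
  also have "\<dots> = (\<Prod>j\<in>UNIV. of_bool (y j = y' j))"
    using assms by (intro prod.cong refl leafless_tree.wmat_complete[OF tree]) (auto simp: plev_alt)
  also have "\<dots> = of_bool (y = y')"
    by (auto simp: fun_eq_iff)
  finally show ?thesis .
qed

lemma pmat_orthogonal:
  assumes "(\<alpha>, x) \<in> pidx \<beta>" "(\<alpha>', x') \<in> pidx \<beta>"
  shows "(\<Sum>y\<in>plev \<beta>. pmat \<alpha> x y * pmat \<alpha>' x' y) = (if \<alpha> = \<alpha>' then \<Prod>j\<in>UNIV. wpj j (x j) (x' j) else 0)"
proof -
  have "(\<Sum>y\<in>plev \<beta>. pmat \<alpha> x y * pmat \<alpha>' x' y)
      = (\<Sum>y\<in>plev \<beta>. \<Prod>j\<in>UNIV. (\<lambda>t. wmj j (\<alpha> j) (x j) t * wmj j (\<alpha>' j) (x' j) t) (y j))"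
    unfolding pmat_def prod.distrib[symmetric] ..
  also have "\<dots> = (\<Prod>j\<in>UNIV. \<Sum>t\<in>levj j (\<beta> j). wmj j (\<alpha> j) (x j) t * wmj j (\<alpha>' j) (x' j) t)"
    unfolding plev_alt by (rule prod_sum_dependent[symmetric]) (rule leafless_tree.finite_lev[OF tree])
  also have "\<dots> = (\<Prod>j\<in>UNIV. if \<alpha> j = \<alpha>' j then wpj j (x j) (x' j) else 0)"
    using assms
    by (intro prod.cong refl leafless_tree.wmat_orthogonal[OF tree])
      (auto simp: pidx_def leafless_tree.idx_def[OF tree] prodV_def alpha_def fun_eq_iff)
  also have "\<dots> = (if \<alpha> = \<alpha>' then \<Prod>j\<in>UNIV. wpj j (x j) (x' j) else 0)"
    by (auto simp: fun_eq_iff intro!: prod_zero)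
  finally show ?thesis .
qed

section \<open>Sibling sets in one coordinate direction\<close>

lemma chij_iff: "v \<in> VV \<Longrightarrow> w \<in> chij j v \<longleftrightarrow> w \<in> VV \<and> w j \<noteq> rt j \<and> par_j Et j w = v"
  using leafless_tree.chi_iff[OF tree[of j]]
  by (auto simp: chi_j_def par_j_def prodV_def fun_eq_iff) metis+

lemma chij_image: "chij j v = (\<lambda>t. v(j := t)) ` children (Et j) (v j)"
proof (intro set_eqI iffI)
  fix w assume "w \<in> chij j v"
  then have "w = v(j := w j)" "w j \<in> children (Et j) (v j)" by (auto simp: chi_j_def fun_eq_iff)
  then show "w \<in> (\<lambda>t. v(j := t)) ` children (Et j) (v j)" by blast
qed (auto simp: chi_j_def)

lemma sum_chij: "(\<Sum>w\<in>chij j v. F w) = (\<Sum>t\<in>children (Et j) (v j). F (v(j := t)))"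
  unfolding chij_image by (subst sum.reindex) (auto simp: inj_on_def fun_eq_iff)

lemma card_chij: "card (chij j v) = card (children (Et j) (v j))"
  unfolding chij_image by (rule card_image) (auto simp: inj_on_def fun_eq_iff)

lemma finite_chij: "v \<in> VV \<Longrightarrow> finite (chij j v)"
  unfolding chij_image using leafless_tree.finite_chi[OF tree] by (auto simp: prodV_def)

lemma card_chij_pos: "v \<in> VV \<Longrightarrow> card (chij j v) > 0"
  unfolding card_chij using leafless_tree.card_chi[OF tree] by (auto simp: prodV_def)

lemma dp_chij: "w \<in> chij j v \<Longrightarrow> dp w = (dp v)(j := Suc (dp v j))"
  using leafless_tree.depth_chi[OF tree[of j]] by (auto simp: alpha_def chi_j_def fun_eq_iff)

lemma dp_0_iff: "y \<in> VV \<Longrightarrow> dp y j = 0 \<longleftrightarrow> y j = rt j"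
  using leafless_tree.depth_0_iff[OF tree[of j]] by (auto simp: alpha_def prodV_def)

lemma par_j_in: "y \<in> VV \<Longrightarrow> y j \<noteq> rt j \<Longrightarrow> par_j Et j y \<in> VV"
  using leafless_tree.parent_in[OF tree[of j]] by (auto simp: par_j_def prodV_def)

lemma in_chij_par_j: "y \<in> VV \<Longrightarrow> y j \<noteq> rt j \<Longrightarrow> y \<in> chij j (par_j Et j y)"
  using chij_iff par_j_in by blast

lemma plev_Suc: "plev (\<beta>(j := Suc (\<beta> j))) = (\<Union>v\<in>plev \<beta>. chij j v)"
proof (intro set_eqI iffI)
  fix y assume y: "y \<in> plev (\<beta>(j := Suc (\<beta> j)))"
  then have V: "y \<in> VV" "y j \<noteq> rt j" using dp_0_iff[of y j] by (auto simp: plev_def)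
  have *: "y \<in> chij j (par_j Et j y)" using V in_chij_par_j by simp
  have "(dp (par_j Et j y))(j := Suc (dp (par_j Et j y) j)) = \<beta>(j := Suc (\<beta> j))"
    using dp_chij[OF *] y by (simp add: plev_def)
  then have "dp (par_j Et j y) k = \<beta> k" for k
    by (cases "k = j") (auto simp: fun_eq_iff split: if_splits)
  then have "par_j Et j y \<in> plev \<beta>" using V par_j_in by (auto simp: plev_def)
  with * show "y \<in> (\<Union>v\<in>plev \<beta>. chij j v)" by blast
next
  fix y assume "y \<in> (\<Union>v\<in>plev \<beta>. chij j v)"
  then show "y \<in> plev (\<beta>(j := Suc (\<beta> j)))"
    using dp_chij chij_iff by (auto simp: plev_def)
qed

lemma sum_plev_Suc:
  "(\<Sum>y\<in>plev (\<beta>(j := Suc (\<beta> j))). F y) = (\<Sum>v\<in>plev \<beta>. \<Sum>y\<in>chij j v. F y)"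
  unfolding plev_Suc
  by (rule sum.UNION_disjoint) (auto simp: finite_plev finite_chij plev_in chij_iff)

lemma pmat_upd_left:
  "pmat \<alpha> (v(j := t)) y = wmj j (\<alpha> j) t (y j) * (\<Prod>i\<in>UNIV - {j}. wmj i (\<alpha> i) (v i) (y i))"
  unfolding pmat_def by (subst prod.remove[of UNIV j]) (auto intro!: prod.cong)

lemma pmat_upd_right:
  "pmat \<alpha> x (v(j := t)) = wmj j (\<alpha> j) (x j) t * (\<Prod>i\<in>UNIV - {j}. wmj i (\<alpha> i) (x i) (v i))"
  unfolding pmat_def by (subst prod.remove[of UNIV j]) (auto intro!: prod.cong)

lemma pmat_chij_sum_left:
  assumes "v \<in> VV" "y \<in> VV"
  shows "(\<Sum>w\<in>chij j v. pmat \<alpha> w y) = 0"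
  unfolding sum_chij pmat_upd_left sum_distrib_right[symmetric]
  using leafless_tree.wmat_chi_sum_left[OF tree[of j]] assms by (simp add: prodV_def)

text \<open>Only coordinate \<open>j\<close> varies over \<open>chij j v\<close>, so the single-tree
  identity applies with the other factors as constants.\<close>

lemma pmat_chij_sum_right:
  assumes "v \<in> VV" "x \<in> VV"
  shows "(\<Sum>w\<in>chij j v. pmat \<alpha> x w)
    = (if \<alpha> j = 0 then 0 else sqrt (card (chij j v)) * pmat (\<alpha>(j := \<alpha> j - 1)) x v)"
proof -
  have "(\<Sum>w\<in>chij j v. pmat \<alpha> x w)
      = (case \<alpha> j of 0 \<Rightarrow> 0 | Suc l \<Rightarrow> sqrt (card (chij j v)) * wmj j l (x j) (v j))
        * (\<Prod>i\<in>UNIV - {j}. wmj i (\<alpha> i) (x i) (v i))"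
    unfolding sum_chij pmat_upd_right sum_distrib_right[symmetric] card_chij
    using leafless_tree.wmat_chi_sum_right[OF tree[of j]] assms by (simp add: prodV_def)
  moreover have "pmat (\<alpha>(j := l)) x v = wmj j l (x j) (v j) * (\<Prod>i\<in>UNIV - {j}. wmj i (\<alpha> i) (x i) (v i))" for l
    unfolding pmat_def by (subst prod.remove[of UNIV j]) (auto intro!: prod.cong)
  ultimately show ?thesis by (cases "\<alpha> j") auto
qed

text \<open>The weights of the multishift are constant on each \<open>chij j v\<close>, so the joint kernel does not depend on them.\<close>
definition balanced :: "(('d \<Rightarrow> 'a) \<Rightarrow> complex) set" where
  "balanced = {e. (\<forall>x. x \<notin> VV \<longrightarrow> e x = 0) \<and> (\<forall>j. \<forall>v\<in>VV. (\<Sum>w\<in>chij j v. e w) = 0)}"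

text \<open>As \<open>\<beta> j > 0\<close>, the level is a disjoint union of sibling sets in
  direction \<open>j\<close>; over each of them \<open>c\<close> is constant and \<open>e\<close>
  sums to 0.\<close>

lemma balanced_sum_0:
  assumes e: "e \<in> balanced" and "\<beta> j > 0"
    and c: "\<And>v y y'. v \<in> VV \<Longrightarrow> y \<in> chij j v \<Longrightarrow> y' \<in> chij j v \<Longrightarrow> c y = c y'"
  shows "(\<Sum>y\<in>plev \<beta>. c y * e y) = 0"
proof -
  define \<gamma> where "\<gamma> = \<beta>(j := \<beta> j - 1)"
  have \<beta>: "\<beta> = \<gamma>(j := Suc (\<gamma> j))" using assms by (auto simp: \<gamma>_def)
  have "(\<Sum>y\<in>chij j v. c y * e y) = 0" if v: "v \<in> VV" for v
  proof -
    obtain y0 where y0: "y0 \<in> chij j v" using card_chij_pos[OF v, of j] by fastforce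
    have "c y = c y0" if "y \<in> chij j v" for y
      using c[OF v that y0] .
    then have "(\<Sum>y\<in>chij j v. c y * e y) = (\<Sum>y\<in>chij j v. c y0 * e y)"
      by simp
    also have "\<dots> = 0"
      using e v by (simp add: balanced_def sum_distrib_left[symmetric])
    finally show ?thesis .
  qed
  then show ?thesis by (subst \<beta>) (simp add: sum_plev_Suc plev_in)
qed

lemma balanced_reproduce:
  assumes e: "e \<in> balanced" and x: "x \<in> VV"
  shows "(\<Sum>y\<in>plev (dp x). complex_of_real (\<Prod>j\<in>UNIV. wpj j (x j) (y j)) * e y) = e x"
proof -
  \<comment> \<open>Interpolates between the identity, for \<open>J\<close> empty, and the full
    projection, for \<open>J = UNIV\<close>, so that coordinates are exchanged one at a
    time.\<close>
  define c where "c J y = (\<Prod>j\<in>UNIV. if j \<in> J then wpj j (x j) (y j) else of_bool (x j = y j))" for J y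
  have "(\<Sum>y\<in>plev (dp x). complex_of_real (c J y) * e y) = e x" if "finite J" for J
    using that
  proof (induction J)
    case empty
    have "complex_of_real (c {} y) * e y = (if x = y then e y else 0)" for y
      by (auto simp: c_def fun_eq_iff)
    then show ?case
      using x finite_plev[of "dp x"] by (simp add: plev_def)
  next
    case (insert i J)
    define R where "R y = (\<Prod>j\<in>UNIV - {i}. if j \<in> J then wpj j (x j) (y j) else of_bool (x j = y j))" for y
    have c1: "c (insert i J) y = wpj i (x i) (y i) * R y" for y
      unfolding c_def R_def by (subst prod.remove[of UNIV i]) (auto intro!: prod.cong)
    have c2: "c J y = of_bool (x i = y i) * R y" for y
      unfolding c_def R_def by (subst prod.remove[of UNIV i]) (auto simp: insert intro!: prod.cong)
    \<comment> \<open>The error of one exchange is constant on siblings in direction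
      \<open>i\<close>, hence pairs to 0 with \<open>e\<close>; at the root there is no
      error.\<close>
    define d where "d y = (wpj i (x i) (y i) - of_bool (x i = y i)) * R y" for y
    have "(\<Sum>y\<in>plev (dp x). complex_of_real (d y) * e y) = 0"
    proof (cases "x i = rt i")
      case True
      then show ?thesis by (simp add: d_def leafless_tree.wproj_root[OF tree])
    next
      case False
      then have "dp x i > 0" using dp_0_iff[OF x, of i] by simp
      then show ?thesis
      proof (rule balanced_sum_0[OF e])
        fix v y y' assume vy: "v \<in> VV" "y \<in> chij i v" "y' \<in> chij i v"
        then have "R y = R y'"
          unfolding R_def by (intro prod.cong) (auto simp: chi_j_def)
        moreover have "wpj i (x i) (y i) - of_bool (x i = y i) = wpj i (x i) (y' i) - of_bool (x i = y' i)"
          using vy by (intro leafless_tree.wproj_offdiag[OF tree]) (auto simp: chi_j_def)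
        ultimately show "complex_of_real (d y) = complex_of_real (d y')"
          by (simp add: d_def)
      qed
    qed
    moreover have "c (insert i J) y = c J y + d y" for y
      unfolding c1 c2 d_def by (simp add: algebra_simps)
    ultimately show ?case
      using insert.IH by (simp add: distrib_right sum.distrib)
  qed
  from this[of UNIV] show ?thesis by (simp add: c_def)
qed

text \<open>With \<open>T\<^sub>j\<close> the isometric shifts in the coordinate directions, \<open>coef f \<alpha>\<close> is the component of \<open>f\<close> in the Wold
  decomposition, \<open>f = (\<Sum>\<alpha>. T^\<alpha> (coef f \<alpha>))\<close>, and \<open>synth\<close> is the inverse of this analysis map.\<close>
definition coef :: "(('d \<Rightarrow> 'a) \<Rightarrow> complex) \<Rightarrow> ('d \<Rightarrow> nat) \<Rightarrow> ('d \<Rightarrow> 'a) \<Rightarrow> complex" where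
  "coef f \<alpha> x = (if x \<in> VV then \<Sum>y\<in>plev (\<lambda>j. \<alpha> j + dp x j). complex_of_real (pmat \<alpha> x y) * f y else 0)"

definition synth :: "(('d \<Rightarrow> nat) \<Rightarrow> ('d \<Rightarrow> 'a) \<Rightarrow> complex) \<Rightarrow> ('d \<Rightarrow> 'a) \<Rightarrow> complex" where
  "synth h y = (if y \<in> VV then \<Sum>(\<alpha>, x)\<in>pidx (dp y). complex_of_real (pmat \<alpha> x y) * h \<alpha> x else 0)"

section \<open>Wold analysis and synthesis\<close>

lemma coef_add: "coef (\<lambda>x. f x + g x) \<alpha> x = coef f \<alpha> x + coef g \<alpha> x"
  by (simp add: coef_def distrib_left sum.distrib)

lemma coef_cmult: "coef (\<lambda>x. c * f x) \<alpha> x = c * coef f \<alpha> x"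
  by (simp add: coef_def sum_distrib_left mult_ac)

text \<open>The children of \<open>v\<close> in direction \<open>j\<close> share one depth, hence
  one level \<beta>, so the sum over them can be taken inside, where it annihilates
  \<open>pmat\<close>.\<close>

lemma coef_balanced: "coef f \<alpha> \<in> balanced"
proof -
  have "(\<Sum>w\<in>chij j v. coef f \<alpha> w) = 0" if v: "v \<in> VV" for j v
  proof -
    define \<beta> where "\<beta> = (\<lambda>i. \<alpha> i + ((dp v)(j := Suc (dp v j))) i)"
    have "(\<Sum>w\<in>chij j v. coef f \<alpha> w) = (\<Sum>w\<in>chij j v. \<Sum>y\<in>plev \<beta>. complex_of_real (pmat \<alpha> w y) * f y)"
    proof (rule sum.cong[OF refl])
      fix w assume w: "w \<in> chij j v"
      then have "w \<in> VV" using chij_iff v by blast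
      then show "coef f \<alpha> w = (\<Sum>y\<in>plev \<beta>. complex_of_real (pmat \<alpha> w y) * f y)"
        unfolding coef_def \<beta>_def dp_chij[OF w] by simp
    qed
    also have "\<dots> = (\<Sum>y\<in>plev \<beta>. complex_of_real (\<Sum>w\<in>chij j v. pmat \<alpha> w y) * f y)"
      by (subst sum.swap) (simp add: sum_distrib_right)
    also have "\<dots> = 0"
      using pmat_chij_sum_left[OF v] plev_in by (intro sum.neutral) simp
    finally show ?thesis .
  qed
  then show ?thesis by (simp add: balanced_def coef_def)
qed

text \<open>The rows are indexed redundantly by vertices instead of by a basis of \<open>E\<close>,
  yet by \<open>pmat_complete\<close> the columns are orthonormal.\<close>

lemma parseval_level:
  "(\<Sum>(\<alpha>, x)\<in>pidx \<beta>. coef f \<alpha> x * cnj (coef g \<alpha> x)) = (\<Sum>y\<in>plev \<beta>. f y * cnj (g y))"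
proof -
  have "(\<Sum>(\<alpha>, x)\<in>pidx \<beta>. coef f \<alpha> x * cnj (coef g \<alpha> x))
      = (\<Sum>(\<alpha>, x)\<in>pidx \<beta>. \<Sum>y\<in>plev \<beta>. \<Sum>y'\<in>plev \<beta>.
          complex_of_real (pmat \<alpha> x y * pmat \<alpha> x y') * (f y * cnj (g y')))"
    by (rule sum.cong) (auto simp: pidx_def coef_def sum_product mult_ac)
  also have "\<dots> = (\<Sum>y\<in>plev \<beta>. \<Sum>y'\<in>plev \<beta>.
          complex_of_real (\<Sum>(\<alpha>, x)\<in>pidx \<beta>. pmat \<alpha> x y * pmat \<alpha> x y') * (f y * cnj (g y')))"
    unfolding case_prod_unfold
    by (subst sum.swap, rule sum.cong[OF refl], subst sum.swap) (simp add: sum_distrib_right)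
  also have "\<dots> = (\<Sum>y\<in>plev \<beta>. \<Sum>y'\<in>plev \<beta>. of_bool (y = y') * (f y * cnj (g y')))"
    by (intro sum.cong refl) (simp add: pmat_complete)
  also have "\<dots> = (\<Sum>y\<in>plev \<beta>. f y * cnj (g y))"
    using finite_plev[of \<beta>]
    by (intro sum.cong refl) (simp add: of_bool_def if_distrib[of "\<lambda>c. c * _"] sum.delta cong: if_cong)
  finally show ?thesis .
qed

lemma parseval_level_norm:
  "(\<Sum>(\<alpha>, x)\<in>pidx \<beta>. (cmod (coef f \<alpha> x))\<^sup>2) = (\<Sum>y\<in>plev \<beta>. (cmod (f y))\<^sup>2)"
proof -
  have "complex_of_real (\<Sum>(\<alpha>, x)\<in>pidx \<beta>. (cmod (coef f \<alpha> x))\<^sup>2) = complex_of_real (\<Sum>y\<in>plev \<beta>. (cmod (f y))\<^sup>2)"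
    using parseval_level[of f f \<beta>] by (simp add: complex_norm_square case_prod_unfold del: of_real_power)
  then show ?thesis using of_real_eq_iff by blast
qed

lemma coef_eq_0_imp:
  assumes "\<And>\<alpha> x. coef f \<alpha> x = 0" "y \<in> VV"
  shows "f y = 0"
proof -
  have "(\<Sum>y\<in>plev (dp y). (cmod (f y))\<^sup>2) = 0"
    using parseval_level_norm[where f=f and \<beta>="dp y"] assms(1) by (simp add: case_prod_unfold)
  then have "(cmod (f y))\<^sup>2 = 0"
    using finite_plev assms(2) by (subst (asm) sum_nonneg_eq_0_iff) (auto simp: plev_def)
  then show ?thesis by simp
qed

text \<open>Orthogonality of \<open>pmat\<close> leaves only the block of exponent \<alpha>, which
  is the projection onto the joint kernel and fixes \<open>h \<alpha>\<close>.\<close>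

lemma coef_synth:
  assumes h: "\<And>\<alpha>. h \<alpha> \<in> balanced"
  shows "coef (synth h) \<alpha> x = h \<alpha> x"
proof (cases "x \<in> VV")
  case False
  then show ?thesis using h[of \<alpha>] by (auto simp: coef_def balanced_def)
next
  case x: True
  define \<beta> where "\<beta> = (\<lambda>j. \<alpha> j + dp x j)"
  have ax: "(\<alpha>, x) \<in> pidx \<beta>" using x by (simp add: pidx_def \<beta>_def)
  have "coef (synth h) \<alpha> x = (\<Sum>y\<in>plev \<beta>. \<Sum>q\<in>pidx \<beta>.
      complex_of_real (pmat \<alpha> x y * pmat (fst q) (snd q) y) * h (fst q) (snd q))"
    using x unfolding coef_def \<beta>_def[symmetric]
    by (auto simp: synth_def plev_def sum_distrib_left case_prod_unfold mult_ac intro!: sum.cong)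
  also have "\<dots> = (\<Sum>q\<in>pidx \<beta>. complex_of_real (\<Sum>y\<in>plev \<beta>. pmat \<alpha> x y * pmat (fst q) (snd q) y) * h (fst q) (snd q))"
    by (subst sum.swap) (simp add: sum_distrib_right)
  also have "\<dots> = (\<Sum>q\<in>pidx \<beta>. (if \<alpha> = fst q then complex_of_real (\<Prod>j\<in>UNIV. wpj j (x j) (snd q j)) * h \<alpha> (snd q) else 0))"
    by (intro sum.cong refl) (use pmat_orthogonal[OF ax] in \<open>auto simp del: of_real_sum of_real_prod\<close>)
  also have "\<dots> = (\<Sum>q\<in>Pair \<alpha> ` plev (dp x). complex_of_real (\<Prod>j\<in>UNIV. wpj j (x j) (snd q j)) * h \<alpha> (snd q))"
    by (rule sum.mono_neutral_cong_right) (use finite_pidx[of \<beta>] in \<open>auto simp: pidx_def plev_def \<beta>_def fun_eq_iff\<close>)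
  also have "\<dots> = (\<Sum>y\<in>plev (dp x). complex_of_real (\<Prod>j\<in>UNIV. wpj j (x j) (y j)) * h \<alpha> y)"
    by (subst sum.reindex) (auto simp: inj_on_def)
  also have "\<dots> = h \<alpha> x"
    using balanced_reproduce[OF h x] .
  finally show ?thesis .
qed

lemma weight_chij:
  assumes "v \<in> VV" "y \<in> chij j v"
  shows "weight Et rt a j y = 1 / sqrt (card (chij j v)) * sqrt ((dp v j + 1) / (mabs (dp v) + a))"
  using assms chij_iff[OF assms(1)] by (simp add: weight_def mabs_def)

lemma weight_chij_pos: "v \<in> VV \<Longrightarrow> y \<in> chij j v \<Longrightarrow> weight Et rt a j y > 0"
  using card_chij_pos[of v j] a_pos
  by (simp add: weight_chij add_nonneg_pos real_sqrt_gt_0_iff)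

text \<open>On a single level the depth factor \<open>s\<close> of the weights is constant, so the
  multishift is \<open>s\<close> times the isometric shift, and the latter raises the exponent of a
  Wold component by one in direction \<open>j\<close>.\<close>

lemma coef_shift:
  assumes x: "x \<in> VV"
  shows "coef (shift Vt Et rt a j f) \<alpha> x = (if \<alpha> j = 0 then 0 else
    complex_of_real (sqrt ((\<alpha> j + dp x j) / (real (mabs (\<alpha>(j := \<alpha> j - 1)) + mabs (dp x)) + a)))
      * coef f (\<alpha>(j := \<alpha> j - 1)) x)"
proof (cases "\<alpha> j + dp x j")
  case 0
  then have "shift Vt Et rt a j f y = 0" if "y \<in> plev (\<lambda>j. \<alpha> j + dp x j)" for y
    using that dp_0_iff[of y j] by (auto simp: shift_def plev_def fun_eq_iff)
  with 0 show ?thesis by (simp add: coef_def)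
next
  case (Suc b)
  define \<beta> where "\<beta> = (\<lambda>j. \<alpha> j + dp x j)"
  define \<gamma> where "\<gamma> = \<beta>(j := b)"
  have \<beta>: "\<beta> = \<gamma>(j := Suc (\<gamma> j))" using Suc by (auto simp: \<gamma>_def \<beta>_def)
  define s where "s = sqrt ((real b + 1) / (real (mabs \<gamma>) + a))"
  have "coef (shift Vt Et rt a j f) \<alpha> x
      = (\<Sum>v\<in>plev \<gamma>. \<Sum>y\<in>chij j v. complex_of_real (pmat \<alpha> x y) * shift Vt Et rt a j f y)"
    using x sum_plev_Suc[of _ \<gamma> j] \<beta> by (simp add: coef_def \<beta>_def)
  also have "\<dots> = (\<Sum>v\<in>plev \<gamma>. \<Sum>y\<in>chij j v. complex_of_real (pmat \<alpha> x y * (s / sqrt (card (chij j v)))) * f v)"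
  proof (intro sum.cong refl)
    fix v y assume "v \<in> plev \<gamma>" and y: "y \<in> chij j v"
    then have v: "v \<in> VV" "dp v = \<gamma>" by (auto simp: plev_def)
    then have "shift Vt Et rt a j f y = complex_of_real (s / sqrt (card (chij j v))) * f v"
      using y chij_iff[OF v(1)] weight_chij[OF v(1) y] by (simp add: shift_def s_def \<gamma>_def add.commute)
    then show "complex_of_real (pmat \<alpha> x y) * shift Vt Et rt a j f y
        = complex_of_real (pmat \<alpha> x y * (s / sqrt (card (chij j v)))) * f v" by simp
  qed
  also have "\<dots> = (\<Sum>v\<in>plev \<gamma>. complex_of_real ((\<Sum>y\<in>chij j v. pmat \<alpha> x y) * (s / sqrt (card (chij j v)))) * f v)"
    by (simp add: sum_distrib_right sum_divide_distrib)
  also have "\<dots> = (\<Sum>v\<in>plev \<gamma>. if \<alpha> j = 0 then 0 else complex_of_real s * (complex_of_real (pmat (\<alpha>(j := \<alpha> j - 1)) x v) * f v))"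
  proof (intro sum.cong refl)
    fix v assume "v \<in> plev \<gamma>"
    then have v: "v \<in> VV" by (rule plev_in)
    show "complex_of_real ((\<Sum>y\<in>chij j v. pmat \<alpha> x y) * (s / sqrt (card (chij j v)))) * f v
      = (if \<alpha> j = 0 then 0 else complex_of_real s * (complex_of_real (pmat (\<alpha>(j := \<alpha> j - 1)) x v) * f v))"
      unfolding pmat_chij_sum_right[OF v x] using card_chij_pos[OF v, of j] by auto
  qed
  also have "\<dots> = (if \<alpha> j = 0 then 0 else complex_of_real s * coef f (\<alpha>(j := \<alpha> j - 1)) x)"
  proof (cases "\<alpha> j = 0")
    case False
    then have "\<gamma> = (\<lambda>i. (\<alpha>(j := \<alpha> j - 1)) i + dp x i)"
      using Suc by (auto simp: \<gamma>_def \<beta>_def)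
    with False show ?thesis using x by (simp add: coef_def sum_distrib_left)
  qed simp
  also have "\<dots> = (if \<alpha> j = 0 then 0 else
    complex_of_real (sqrt ((\<alpha> j + dp x j) / (real (mabs (\<alpha>(j := \<alpha> j - 1)) + mabs (dp x)) + a)))
      * coef f (\<alpha>(j := \<alpha> j - 1)) x)"
  proof (cases "\<alpha> j = 0")
    case False
    then have "\<gamma> = (\<lambda>i. (\<alpha>(j := \<alpha> j - 1)) i + dp x i)"
      using Suc by (auto simp: \<gamma>_def \<beta>_def)
    then have "mabs \<gamma> = mabs (\<alpha>(j := \<alpha> j - 1)) + mabs (dp x)"
      by (simp add: mabs_def sum.distrib)
    moreover have "real b + 1 = real (\<alpha> j + dp x j)" using Suc by simp
    ultimately show ?thesis by (simp add: s_def)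
  qed simp
  finally show ?thesis .
qed

text \<open>Off this set, a vertex is an only child in some direction, and balanced functions vanish
  there. Finite branching makes the set finite, so pairings with the joint kernel are finite
  sums.\<close>

definition vsupp :: "('d \<Rightarrow> 'a) set" where
  "vsupp = {x. \<forall>j. x j \<in> {t \<in> Vt j. t = rt j \<or> card (children (Et j) (parent (Et j) t)) \<ge> 2}}"

lemma finite_vsupp: "finite vsupp"
  unfolding vsupp_def
  by (rule finite_dependent_functions) (rule leafless_tree.finite_branching_children[OF tree fin_branch])

lemma vsupp_subset: "vsupp \<subseteq> VV"
  by (auto simp: vsupp_def prodV_def)

lemma balanced_supp:
  assumes e: "e \<in> balanced" and x: "x \<notin> vsupp"
  shows "e x = 0"
proof (cases "x \<in> VV")
  case False
  then show ?thesis using e by (simp add: balanced_def)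
next
  case True
  then obtain j where j: "x j \<noteq> rt j" "card (children (Et j) (parent (Et j) (x j))) < 2"
    using x by (auto simp: vsupp_def prodV_def not_le)
  have v: "par_j Et j x \<in> VV" using par_j_in True j by blast
  have xc: "x \<in> chij j (par_j Et j x)" using in_chij_par_j True j by blast
  have "card (chij j (par_j Et j x)) = 1"
    using j card_chij_pos[OF v, of j] by (simp add: card_chij par_j_def)
  then have "chij j (par_j Et j x) = {x}"
    using xc by (auto simp: card_1_singleton_iff)
  then show ?thesis using e v by (auto simp: balanced_def dest!: spec[of _ j] bspec)
qed

section \<open>Identification of the joint kernel\<close>

lemma balanced_l2: "e \<in> balanced \<Longrightarrow> e \<in> l2 VV"
  using l2_finite_support[OF finite_vsupp vsupp_subset] balanced_supp by blast

lemma l2_inner_balanced: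
  assumes "e \<in> balanced"
  shows "l2_inner VV e g = (\<Sum>x\<in>vsupp. e x * cnj (g x))" "l2_inner VV g e = (\<Sum>x\<in>vsupp. g x * cnj (e x))"
  unfolding l2_inner_def
  by (rule infsum_finite_support; use finite_vsupp vsupp_subset balanced_supp[OF assms] in auto)+

lemma shift_orthogonal_balanced:
  assumes e: "e \<in> balanced"
  shows "l2_inner VV (shift Vt Et rt a j g) e = 0"
proof -
  \<comment> \<open>\<open>balanced_sum_0\<close> works on whole levels, so \<open>vsupp\<close> is
    enlarged to the union of the levels it meets.\<close>
  define L where "L = (\<Union>\<beta>\<in>dp ` vsupp. plev \<beta>)"
  have L: "finite L" "vsupp \<subseteq> L" "L \<subseteq> VV"
    using finite_vsupp finite_plev vsupp_subset by (auto simp: L_def plev_def)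
  have "l2_inner VV (shift Vt Et rt a j g) e = (\<Sum>x\<in>L. shift Vt Et rt a j g x * cnj (e x))"
    unfolding l2_inner_def
    by (rule infsum_finite_support) (use L balanced_supp[OF e] in auto)
  also have "\<dots> = (\<Sum>\<beta>\<in>dp ` vsupp. \<Sum>x\<in>plev \<beta>. shift Vt Et rt a j g x * cnj (e x))"
    unfolding L_def
    by (rule sum.UNION_disjoint) (auto simp: finite_vsupp finite_plev, auto simp: plev_def)
  also have "\<dots> = 0"
  proof (rule sum.neutral, rule ballI)
    fix \<beta>
    have "(\<Sum>x\<in>plev \<beta>. cnj (shift Vt Et rt a j g x) * e x) = 0"
    proof (cases "\<beta> j")
      case 0
      then have "shift Vt Et rt a j g x = 0" if "x \<in> plev \<beta>" for x
        using that dp_0_iff[of x j] by (auto simp: shift_def plev_def)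
      then show ?thesis by simp
    next
      case (Suc n)
      show ?thesis
      proof (rule balanced_sum_0[OF e])
        show "\<beta> j > 0" using Suc by simp
        fix v y y' assume v: "v \<in> VV" and y: "y \<in> chij j v" "y' \<in> chij j v"
        then show "cnj (shift Vt Et rt a j g y) = cnj (shift Vt Et rt a j g y')"
          using weight_chij[OF v y(1)] weight_chij[OF v y(2)] chij_iff[OF v]
          by (simp add: shift_def)
      qed
    qed
    then have "cnj (\<Sum>x\<in>plev \<beta>. cnj (shift Vt Et rt a j g x) * e x) = 0" by simp
    then show "(\<Sum>x\<in>plev \<beta>. shift Vt Et rt a j g x * cnj (e x)) = 0" by simp
  qed
  finally show ?thesis .
qed

lemma jointKer_eq: "jointKer Vt Et rt a = balanced"
proof
  show "balanced \<subseteq> jointKer Vt Et rt a"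
    using balanced_l2 shift_orthogonal_balanced by (auto simp: jointKer_def)
next
  show "jointKer Vt Et rt a \<subseteq> balanced"
  proof
    fix f assume f: "f \<in> jointKer Vt Et rt a"
    have "(\<Sum>w\<in>chij j v. f w) = 0" if v: "v \<in> VV" for j v
    proof -
      \<comment> \<open>Testing with the basis vector at \<open>v\<close> suffices: its image is a
        nonzero constant \<open>c\<close> on the children of \<open>v\<close> in direction
        \<open>j\<close>.\<close>
      define g where "g x = (if x = v then 1 else 0 :: complex)" for x
      have g: "g \<in> l2 VV"
        by (rule l2_finite_support[of "{v}"]) (use v in \<open>auto simp: g_def\<close>)
      obtain y where y: "y \<in> chij j v" using card_chij_pos[OF v, of j] by fastforce
      define c where "c = complex_of_real (weight Et rt a j y)"
      have c: "c \<noteq> 0" using weight_chij_pos[OF v y] by (simp add: c_def)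
      have s: "shift Vt Et rt a j g x = (if x \<in> chij j v then c else 0)" for x
        using chij_iff[OF v, of x j] weight_chij[OF v y] weight_chij[OF v, of x j]
        by (auto simp: shift_def g_def c_def)
      have "0 = l2_inner VV (shift Vt Et rt a j g) f"
        using f g by (simp add: jointKer_def)
      also have "\<dots> = (\<Sum>x\<in>chij j v. shift Vt Et rt a j g x * cnj (f x))"
        unfolding l2_inner_def
        by (rule infsum_finite_support) (use finite_chij[OF v] chij_iff[OF v] in \<open>auto simp: s\<close>)
      also have "\<dots> = c * cnj (\<Sum>x\<in>chij j v. f x)"
        by (simp add: s sum_distrib_left)
      finally show ?thesis using c by (metis complex_cnj_zero_iff mult_eq_0_iff)
    qed
    then show "f \<in> balanced" using f by (simp add: balanced_def jointKer_def l2_def)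
  qed
qed

section \<open>Parseval on the whole of \<open>l2\<close>\<close>

lemma fibre_plev: "{y \<in> VV. dp y = \<beta>} = plev \<beta>"
  by (simp add: plev_def)

lemma fibre_pidx: "{q \<in> UNIV \<times> VV. (\<lambda>j. fst q j + dp (snd q) j) = \<beta>} = pidx \<beta>"
  by (auto simp: pidx_def)

lemma l2_iff_coef:
  assumes "\<And>y. y \<notin> VV \<Longrightarrow> f y = 0"
  shows "f \<in> l2 VV \<longleftrightarrow> (\<lambda>(\<alpha>, x). (cmod (coef f \<alpha> x))\<^sup>2) summable_on UNIV \<times> VV"
proof -
  have "f \<in> l2 VV \<longleftrightarrow> (\<lambda>y. (cmod (f y))\<^sup>2) summable_on VV"
    using assms by (auto simp: l2_def)
  also have "\<dots> \<longleftrightarrow> (\<lambda>\<beta>. \<Sum>y\<in>plev \<beta>. (cmod (f y))\<^sup>2) summable_on UNIV"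
    using summable_on_fibres[of VV dp "\<lambda>y. (cmod (f y))\<^sup>2"] by (simp add: fibre_plev finite_plev)
  also have "\<dots> \<longleftrightarrow> (\<lambda>\<beta>. \<Sum>(\<alpha>, x)\<in>pidx \<beta>. (cmod (coef f \<alpha> x))\<^sup>2) summable_on UNIV"
    unfolding parseval_level_norm ..
  also have "\<dots> \<longleftrightarrow> (\<lambda>(\<alpha>, x). (cmod (coef f \<alpha> x))\<^sup>2) summable_on UNIV \<times> VV"
    using summable_on_fibres[of "UNIV \<times> VV" "\<lambda>q j. fst q j + dp (snd q) j" "\<lambda>(\<alpha>, x). (cmod (coef f \<alpha> x))\<^sup>2"]
    by (simp add: fibre_pidx finite_pidx case_prod_unfold)
  finally show ?thesis .
qed

lemma parseval:
  assumes f: "f \<in> l2 VV" and g: "g \<in> l2 VV"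
  shows "(\<lambda>(\<alpha>, x). coef f \<alpha> x * cnj (coef g \<alpha> x)) summable_on UNIV \<times> VV"
    and "l2_inner VV f g = infsum (\<lambda>(\<alpha>, x). coef f \<alpha> x * cnj (coef g \<alpha> x)) (UNIV \<times> VV)"
proof -
  have "(\<lambda>(\<alpha>, x). (cmod (coef f \<alpha> x))\<^sup>2) summable_on UNIV \<times> VV"
    "(\<lambda>(\<alpha>, x). (cmod (coef g \<alpha> x))\<^sup>2) summable_on UNIV \<times> VV"
    using l2_iff_coef f g by (auto simp: l2_def)
  then show s: "(\<lambda>(\<alpha>, x). coef f \<alpha> x * cnj (coef g \<alpha> x)) summable_on UNIV \<times> VV"
    unfolding case_prod_unfold by (rule summable_mult_cnj)
  have "(\<lambda>y. f y * cnj (g y)) summable_on VV"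
    using f g by (intro summable_mult_cnj) (auto simp: l2_def)
  then have "((\<lambda>\<beta>. \<Sum>y\<in>plev \<beta>. f y * cnj (g y)) has_sum l2_inner VV f g) UNIV"
    unfolding l2_inner_def
    by (rule has_sum_fibres[where X = VV and k = dp, unfolded fibre_plev, OF finite_plev])
  moreover have "((\<lambda>\<beta>. \<Sum>(\<alpha>, x)\<in>pidx \<beta>. coef f \<alpha> x * cnj (coef g \<alpha> x))
      has_sum infsum (\<lambda>(\<alpha>, x). coef f \<alpha> x * cnj (coef g \<alpha> x)) (UNIV \<times> VV)) UNIV"
    using has_sum_fibres[OF _ s, of "\<lambda>q j. fst q j + dp (snd q) j"]
    by (simp add: fibre_pidx finite_pidx case_prod_unfold)
  ultimately show "l2_inner VV f g = infsum (\<lambda>(\<alpha>, x). coef f \<alpha> x * cnj (coef g \<alpha> x)) (UNIV \<times> VV)"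
    unfolding parseval_level using has_sum_unique by blast
qed

text \<open>The norm of \<open>f\<close> in \<open>l2\<close>, a bound for all Wold coefficients
  because each level is mapped isometrically.\<close>

definition coef_bound :: "(('d \<Rightarrow> 'a) \<Rightarrow> complex) \<Rightarrow> real" where
  "coef_bound f = sqrt (infsum (\<lambda>y. (cmod (f y))\<^sup>2) VV)"

lemma cmod_coef_le:
  assumes f: "f \<in> l2 VV"
  shows "cmod (coef f \<alpha> x) \<le> coef_bound f"
proof (cases "x \<in> VV")
  case False
  then show ?thesis by (simp add: coef_def coef_bound_def infsum_nonneg)
next
  case True
  define \<beta> where "\<beta> = (\<lambda>j. \<alpha> j + dp x j)"
  have "(\<alpha>, x) \<in> pidx \<beta>" using True by (simp add: pidx_def \<beta>_def)
  then have "(cmod (coef f \<alpha> x))\<^sup>2 \<le> (\<Sum>(\<alpha>, x)\<in>pidx \<beta>. (cmod (coef f \<alpha> x))\<^sup>2)"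
    using member_le_sum[of "(\<alpha>, x)" "pidx \<beta>" "\<lambda>(\<alpha>, x). (cmod (coef f \<alpha> x))\<^sup>2"] finite_pidx by auto
  also have "\<dots> = (\<Sum>y\<in>plev \<beta>. (cmod (f y))\<^sup>2)" by (rule parseval_level_norm)
  also have "\<dots> \<le> infsum (\<lambda>y. (cmod (f y))\<^sup>2) VV"
    using f by (intro finite_sum_le_infsum) (auto simp: l2_def finite_plev dest: plev_in)
  finally show ?thesis unfolding coef_bound_def by (rule real_le_rsqrt)
qed

text \<open>The factor is taken at the depth of each vertex because an element of \<open>E\<close>
  may mix depths. Siblings share a depth, so the values stay in \<open>E\<close>; off the ball, 0 is
  the convention of \<open>holo_Evalued\<close>.\<close>

definition model :: "(('d \<Rightarrow> 'a) \<Rightarrow> complex) \<Rightarrow> complex ^ 'd \<Rightarrow> ('d \<Rightarrow> 'a) \<Rightarrow> complex" where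
  "model f z = (if z \<in> ball 0 1
     then (\<lambda>x. infsum (\<lambda>\<alpha>. complex_of_real (sqrt (ratio a (dp x) \<alpha>)) * coef f \<alpha> x * mpow z \<alpha>) UNIV)
     else (\<lambda>_. 0))"

section \<open>Properties of the function model\<close>

lemma model_term_bound:
  assumes "f \<in> l2 VV"
  shows "cmod (complex_of_real (sqrt (ratio a (dp x) \<alpha>)) * coef f \<alpha> x) \<le> coef_bound f * sqrt (ratio a (dp x) \<alpha>)"
  using mult_right_mono[OF cmod_coef_le[OF assms, of \<alpha> x], of "sqrt (ratio a (dp x) \<alpha>)"] ratio_nonneg[OF a_pos, of "dp x" \<alpha>]
  by (simp add: norm_mult mult.commute)

lemma model_summable:
  assumes "f \<in> l2 VV" "z \<in> ball 0 1"
  shows "(\<lambda>\<alpha>. complex_of_real (sqrt (ratio a (dp x) \<alpha>)) * coef f \<alpha> x * mpow z \<alpha>) summable_on UNIV"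
  using assms by (intro summable_power_series[OF a_pos _ model_term_bound]) auto

lemma model_add:
  assumes "f \<in> l2 VV" "g \<in> l2 VV"
  shows "model (\<lambda>x. f x + g x) = (\<lambda>z x. model f z x + model g z x)"
  using infsum_add[OF model_summable[OF assms(1)] model_summable[OF assms(2)]]
  by (auto simp: model_def fun_eq_iff coef_add algebra_simps)

lemma model_cmult: "model (\<lambda>x. c * f x) = (\<lambda>z x. c * model f z x)"
  by (auto simp: model_def fun_eq_iff coef_cmult infsum_cmult_right'[symmetric] mult_ac)

lemma model_balanced:
  assumes f: "f \<in> l2 VV" and z: "z \<in> ball 0 1"
  shows "model f z \<in> balanced"
proof -
  have "(\<Sum>w\<in>chij j v. model f z w) = 0" if v: "v \<in> VV" for j v
  proof -
    have "(\<Sum>w\<in>chij j v. model f z w)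
        = infsum (\<lambda>\<alpha>. \<Sum>w\<in>chij j v. complex_of_real (sqrt (ratio a (dp w) \<alpha>)) * coef f \<alpha> w * mpow z \<alpha>) UNIV"
      using z by (simp add: model_def sum_infsum_swap[OF finite_chij[OF v] model_summable[OF f z]])
    also have "\<dots> = infsum (\<lambda>_ :: 'd \<Rightarrow> nat. 0) UNIV"
    proof (rule infsum_cong)
      fix \<alpha>
      have "(\<Sum>w\<in>chij j v. complex_of_real (sqrt (ratio a (dp w) \<alpha>)) * coef f \<alpha> w * mpow z \<alpha>)
          = complex_of_real (sqrt (ratio a ((dp v)(j := Suc (dp v j))) \<alpha>)) * (\<Sum>w\<in>chij j v. coef f \<alpha> w) * mpow z \<alpha>"
        unfolding sum_distrib_left sum_distrib_right by (intro sum.cong refl) (simp only: dp_chij)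
      also have "(\<Sum>w\<in>chij j v. coef f \<alpha> w) = 0"
        using coef_balanced v by (simp add: balanced_def)
      finally show "(\<Sum>w\<in>chij j v. complex_of_real (sqrt (ratio a (dp w) \<alpha>)) * coef f \<alpha> w * mpow z \<alpha>) = 0" by simp
    qed
    finally show ?thesis by simp
  qed
  then show ?thesis using z by (simp add: balanced_def model_def coef_def)
qed

text \<open>Terms with \<open>\<alpha> j = 0\<close> vanish, and at a raised exponent the depth
  factor of the shift cancels the quotient in \<open>ratio_Suc\<close>; what is left is the old term
  times \<open>z $ j\<close>.\<close>

lemma model_shift: "model (shift Vt Et rt a j f) = (\<lambda>z x. z $ j * model f z x)"
proof (intro ext)
  fix z x
  show "model (shift Vt Et rt a j f) z x = z $ j * model f z x"
  proof (cases "z \<in> ball 0 1 \<and> x \<in> VV")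
    case False
    then show ?thesis by (auto simp: model_def coef_def)
  next
    case True
    define T where "T \<alpha> = complex_of_real (sqrt (ratio a (dp x) \<alpha>)) * coef (shift Vt Et rt a j f) \<alpha> x * mpow z \<alpha>" for \<alpha>
    define up where "up \<alpha> = \<alpha>(j := Suc (\<alpha> j))" for \<alpha> :: "'d \<Rightarrow> nat"
    have inj: "inj up"
    proof (rule injI)
      fix \<alpha> \<beta> assume e: "up \<alpha> = up \<beta>"
      have "\<alpha> k = \<beta> k" for k using fun_cong[OF e, of k] by (cases "k = j") (auto simp: up_def)
      then show "\<alpha> = \<beta>" by blast
    qed
    have rng: "\<alpha> \<in> range up" if "\<alpha> j \<noteq> 0" for \<alpha>
      by (rule range_eqI[of _ _ "\<alpha>(j := \<alpha> j - 1)"]) (use that in \<open>auto simp: up_def\<close>)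
    have Tup: "T (up \<alpha>) = z $ j * (complex_of_real (sqrt (ratio a (dp x) \<alpha>)) * coef f \<alpha> x * mpow z \<alpha>)" for \<alpha>
    proof -
      define p where "p = real (mabs (dp x) + mabs \<alpha>) + a"
      define q where "q = real (dp x j + \<alpha> j) + 1"
      have pq: "p > 0" "q > 0" using a_pos by (auto simp: p_def q_def add_nonneg_pos)
      have "sqrt (ratio a (dp x) (up \<alpha>)) * sqrt (q / p) = sqrt (ratio a (dp x) \<alpha>)"
        unfolding real_sqrt_mult[symmetric] up_def ratio_Suc p_def[symmetric] q_def[symmetric] using pq by simp
      moreover have "coef (shift Vt Et rt a j f) (up \<alpha>) x = complex_of_real (sqrt (q / p)) * coef f \<alpha> x"
        using True by (subst coef_shift) (auto simp: up_def p_def q_def ac_simps)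
      ultimately have "T (up \<alpha>) = complex_of_real (sqrt (ratio a (dp x) \<alpha>)) * coef f \<alpha> x * mpow z (up \<alpha>)"
        unfolding T_def by (metis mult.assoc of_real_mult)
      then show ?thesis by (simp add: up_def mpow_Suc)
    qed
    have "model (shift Vt Et rt a j f) z x = infsum T UNIV"
      using True by (simp add: model_def T_def[abs_def])
    also have "\<dots> = infsum T (range up)"
    proof (rule infsum_cong_neutral)
      fix \<alpha> assume "\<alpha> \<in> UNIV - range up"
      then have "\<alpha> j = 0" using rng by blast
      then show "T \<alpha> = 0" using True by (simp add: T_def coef_shift)
    qed auto
    also have "\<dots> = infsum (\<lambda>\<alpha>. T (up \<alpha>)) UNIV"
      using infsum_reindex[OF inj, of T] by (simp add: o_def)
    also have "\<dots> = z $ j * model f z x"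
      using True by (simp add: Tup infsum_cmult_right' model_def)
    finally show ?thesis .
  qed
qed

text \<open>At each vertex the power series coincide, so their coefficients do. As
  \<open>ratio\<close> is positive, the Wold coefficients agree, and Parseval on each level recovers
  the vector.\<close>

lemma model_injective:
  assumes "f \<in> l2 VV" "g \<in> l2 VV" "model f = model g"
  shows "f = g"
proof -
  define h where "h x = f x + (-1) * g x" for x
  have c: "coef h \<alpha> x = coef f \<alpha> x - coef g \<alpha> x" for \<alpha> x
    unfolding h_def coef_add coef_cmult by simp
  have "coef h \<alpha> x = 0" for \<alpha> x
  proof -
    define b where "b \<alpha> = complex_of_real (sqrt (ratio a (dp x) \<alpha>)) * coef h \<alpha> x" for \<alpha>
    have "b \<alpha> = 0"
    proof (rule power_series_eq_0[OF a_pos])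
      fix \<alpha>
      have "cmod (coef h \<alpha> x) \<le> coef_bound f + coef_bound g"
        unfolding c using norm_triangle_ineq4 cmod_coef_le[OF assms(1)] cmod_coef_le[OF assms(2)]
        by (meson add_mono order_trans)
      then have "sqrt (ratio a (dp x) \<alpha>) * cmod (coef h \<alpha> x)
          \<le> sqrt (ratio a (dp x) \<alpha>) * (coef_bound f + coef_bound g)"
        by (rule mult_left_mono) (simp add: ratio_nonneg[OF a_pos])
      then show "cmod (b \<alpha>) \<le> (coef_bound f + coef_bound g) * sqrt (ratio a (dp x) \<alpha>)"
        by (simp add: b_def norm_mult ratio_nonneg[OF a_pos] mult.commute)
    next
      fix z :: "complex ^ 'd" assume "norm z < 1"
      then have z: "z \<in> ball 0 1" by simp
      have "infsum (\<lambda>\<alpha>. b \<alpha> * mpow z \<alpha>) UNIV = model f z x - model g z x"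
        using z infsum_add[OF model_summable[OF assms(1) z, of x] summable_on_cmult_right[OF model_summable[OF assms(2) z, of x], of "-1"]]
        by (simp add: model_def b_def c left_diff_distrib right_diff_distrib infsum_uminus)
      then show "infsum (\<lambda>\<alpha>. b \<alpha> * mpow z \<alpha>) UNIV = 0" using assms(3) by simp
    qed
    then show ?thesis using ratio_pos[OF a_pos, of "dp x" \<alpha>] by (simp add: b_def)
  qed
  then have "h y = 0" if "y \<in> VV" for y using coef_eq_0_imp that by blast
  moreover have "h y = 0" if "y \<notin> VV" for y using assms(1,2) that by (simp add: h_def l2_def)
  ultimately have "h y = 0" for y by blast
  then show ?thesis by (auto simp: h_def fun_eq_iff)
qed

text \<open>Values are balanced, so pairing with \<open>g\<close> is a finite linear combination
  over \<open>vsupp\<close> of scalar power series.\<close>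

lemma model_holo:
  assumes f: "f \<in> l2 VV"
  shows "holo_Evalued Vt (jointKer Vt Et rt a) (model f)"
  unfolding holo_Evalued_def
proof (intro conjI ballI allI impI)
  fix z :: "complex ^ 'd"
  show "z \<in> ball 0 1 \<Longrightarrow> model f z \<in> jointKer Vt Et rt a"
    using model_balanced[OF f] jointKer_eq by simp
  show "z \<notin> ball 0 1 \<Longrightarrow> model f z = (\<lambda>_. 0)" by (simp add: model_def)
next
  fix g :: "('d \<Rightarrow> 'a) \<Rightarrow> complex"
  have "holo_scalar (ball 0 1) (\<lambda>z :: complex ^ 'd. \<Sum>x\<in>vsupp.
      infsum (\<lambda>\<alpha>. complex_of_real (sqrt (ratio a (dp x) \<alpha>)) * coef f \<alpha> x * mpow z \<alpha>) UNIV * cnj (g x))"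
    by (intro holo_scalar_linear_combination power_series_holo[OF a_pos model_term_bound[OF f]])
  then show "holo_scalar (ball 0 1) (\<lambda>z. l2_inner VV (model f z) g)"
  proof (rule holo_scalar_cong)
    fix z :: "complex ^ 'd" assume z: "z \<in> ball 0 1"
    show "(\<Sum>x\<in>vsupp. infsum (\<lambda>\<alpha>. complex_of_real (sqrt (ratio a (dp x) \<alpha>)) * coef f \<alpha> x * mpow z \<alpha>) UNIV * cnj (g x))
        = l2_inner VV (model f z) g"
      unfolding l2_inner_balanced(1)[OF model_balanced[OF f z]] using z by (simp add: model_def)
  qed simp
qed

text \<open>Wold components of the vector of \<open>l2 V\<close> which represents \<open>f \<mapsto> \<langle>model f w, e\<rangle>\<close>.\<close>
definition kernel_coef :: "complex ^ 'd \<Rightarrow> (('d \<Rightarrow> 'a) \<Rightarrow> complex) \<Rightarrow> ('d \<Rightarrow> nat) \<Rightarrow> ('d \<Rightarrow> 'a) \<Rightarrow> complex" where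
  "kernel_coef w e \<alpha> x = complex_of_real (sqrt (ratio a (dp x) \<alpha>)) * cnj (mpow w \<alpha>) * e x"

section \<open>Kernel vectors and the reproducing property\<close>

lemma kernel_coef_balanced:
  assumes e: "e \<in> balanced"
  shows "kernel_coef w e \<alpha> \<in> balanced"
proof -
  have "(\<Sum>y\<in>chij j v. kernel_coef w e \<alpha> y) = 0" if v: "v \<in> VV" for j v
  proof -
    have "(\<Sum>y\<in>chij j v. kernel_coef w e \<alpha> y)
      = complex_of_real (sqrt (ratio a ((dp v)(j := Suc (dp v j))) \<alpha>)) * cnj (mpow w \<alpha>) * (\<Sum>y\<in>chij j v. e y)"
      unfolding sum_distrib_left kernel_coef_def by (intro sum.cong refl) (simp only: dp_chij)
    also have "\<dots> = 0" using e v by (simp add: balanced_def)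
    finally show ?thesis .
  qed
  then show ?thesis using e by (simp add: balanced_def kernel_coef_def)
qed

lemma coef_synth_kernel:
  assumes e: "e \<in> balanced"
  shows "coef (synth (kernel_coef w e)) \<alpha> x = kernel_coef w e \<alpha> x"
  using coef_synth kernel_coef_balanced[OF e] by blast

text \<open>Only the finitely many vertices of \<open>vsupp\<close> contribute; at each, the squared
  moduli form the scalar kernel on the diagonal at \<open>w\<close>, times a constant.\<close>

lemma synth_kernel_l2:
  assumes e: "e \<in> balanced" and w: "w \<in> ball 0 1"
  shows "synth (kernel_coef w e) \<in> l2 VV"
proof -
  have supp: "x \<in> vsupp" if "e x \<noteq> 0" for x
    using balanced_supp[OF e] that by blast
  have "(\<lambda>(x, \<alpha>). (cmod (kernel_coef w e \<alpha> x))\<^sup>2) summable_on vsupp \<times> UNIV"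
  proof (rule summable_on_SigmaI)
    fix x
    have "(\<lambda>\<alpha>. (cmod (e x))\<^sup>2 * (ratio a (dp x) \<alpha> * (cmod (mpow w \<alpha>))\<^sup>2)) summable_on UNIV"
      using w by (intro summable_on_cmult_right summable_ratio_mpow_square[OF a_pos]) simp
    then have "(\<lambda>\<alpha>. (cmod (kernel_coef w e \<alpha> x))\<^sup>2) summable_on UNIV"
      by (simp add: kernel_coef_def norm_mult power_mult_distrib ratio_nonneg[OF a_pos] mult_ac)
    then show "((\<lambda>\<alpha>. case (x, \<alpha>) of (x, \<alpha>) \<Rightarrow> (cmod (kernel_coef w e \<alpha> x))\<^sup>2) has_sum
        infsum (\<lambda>\<alpha>. (cmod (kernel_coef w e \<alpha> x))\<^sup>2) UNIV) UNIV" by simp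
  qed (auto simp: finite_vsupp)
  then have "(\<lambda>(\<alpha>, x). (cmod (kernel_coef w e \<alpha> x))\<^sup>2) summable_on UNIV \<times> vsupp"
    by (subst summable_on_swap) (simp add: case_prod_unfold)
  moreover have "(\<lambda>(\<alpha>, x). (cmod (kernel_coef w e \<alpha> x))\<^sup>2) summable_on UNIV \<times> VV \<longleftrightarrow>
      (\<lambda>(\<alpha>, x). (cmod (kernel_coef w e \<alpha> x))\<^sup>2) summable_on UNIV \<times> vsupp"
    by (rule summable_on_cong_neutral)
      (use vsupp_subset supp in \<open>auto simp: kernel_coef_def\<close>)
  ultimately have "(\<lambda>(\<alpha>, x). (cmod (coef (synth (kernel_coef w e)) \<alpha> x))\<^sup>2) summable_on UNIV \<times> VV"
    by (simp add: coef_synth_kernel[OF e])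
  then show ?thesis
    by (subst l2_iff_coef) (auto simp: synth_def)
qed

text \<open>One square root of \<open>ratio\<close> stems from the kernel vector, the other from
  \<open>model\<close>.\<close>

lemma model_synth_kernel:
  assumes e: "e \<in> balanced" and z: "z \<in> ball 0 1"
  shows "model (synth (kernel_coef w e)) z x
    = infsum (\<lambda>\<alpha>. complex_of_real (ratio a (dp x) \<alpha>) * mpow z \<alpha> * cnj (mpow w \<alpha>)) UNIV * e x"
proof -
  have "complex_of_real (sqrt (ratio a (dp x) \<alpha>)) * complex_of_real (sqrt (ratio a (dp x) \<alpha>))
      = complex_of_real (ratio a (dp x) \<alpha>)" for \<alpha>
    using ratio_nonneg[OF a_pos, of "dp x" \<alpha>] by (simp flip: of_real_mult)
  moreover have "s * (s * c * y) * m = s * s * m * c * y" for s c y m :: complex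
    by simp
  ultimately have "complex_of_real (sqrt (ratio a (dp x) \<alpha>)) * coef (synth (kernel_coef w e)) \<alpha> x * mpow z \<alpha>
      = complex_of_real (ratio a (dp x) \<alpha>) * mpow z \<alpha> * cnj (mpow w \<alpha>) * e x" for \<alpha>
    unfolding coef_synth_kernel[OF e] kernel_coef_def by metis
  then have "model (synth (kernel_coef w e)) z x
      = infsum (\<lambda>\<alpha>. complex_of_real (ratio a (dp x) \<alpha>) * mpow z \<alpha> * cnj (mpow w \<alpha>) * e x) UNIV"
    using z by (simp only: model_def if_True)
  then show ?thesis by (simp only: infsum_cmult_left')
qed

text \<open>After Parseval, the factor sqrt(ratio) w^\<alpha> of the kernel vector, moved over to
  \<open>coef f\<close>, rebuilds the series of \<open>model f w\<close> at each vertex; the vertex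
  sum is finite, so it may be interchanged with the series.\<close>

lemma reproducing:
  assumes f: "f \<in> l2 VV" and e: "e \<in> balanced" and w: "w \<in> ball 0 1"
  shows "l2_inner VV f (synth (kernel_coef w e)) = l2_inner VV (model f w) e"
proof -
  define T where "T x \<alpha> = coef f \<alpha> x * cnj (kernel_coef w e \<alpha> x)" for x \<alpha>
  note p = parseval[OF f synth_kernel_l2[OF e w], unfolded coef_synth_kernel[OF e]]
  have supp: "T x \<alpha> = 0" if "x \<notin> vsupp" for x \<alpha>
    using balanced_supp[OF e that] by (simp add: T_def kernel_coef_def)
  have Tx: "T x \<alpha> = complex_of_real (sqrt (ratio a (dp x) \<alpha>)) * coef f \<alpha> x * mpow w \<alpha> * cnj (e x)" for x \<alpha>
    by (simp add: T_def kernel_coef_def mult_ac)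
  have "l2_inner VV f (synth (kernel_coef w e)) = infsum (\<lambda>(\<alpha>, x). T x \<alpha>) (UNIV \<times> VV)"
    unfolding p(2) T_def ..
  also have "\<dots> = infsum (\<lambda>(\<alpha>, x). T x \<alpha>) (UNIV \<times> vsupp)"
    by (rule infsum_cong_neutral) (use vsupp_subset supp in auto)
  also have "\<dots> = infsum (\<lambda>\<alpha>. infsum (\<lambda>x. T x \<alpha>) vsupp) UNIV"
  proof (rule infsum_Sigma'_banach[symmetric])
    show "(\<lambda>(\<alpha>, x). T x \<alpha>) summable_on UNIV \<times> vsupp"
      by (rule summable_on_subset_banach[OF p(1)[folded T_def]]) (use vsupp_subset in auto)
  qed
  also have "\<dots> = infsum (\<lambda>\<alpha>. \<Sum>x\<in>vsupp. T x \<alpha>) UNIV"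
    by (simp add: finite_vsupp)
  also have "\<dots> = (\<Sum>x\<in>vsupp. infsum (T x) UNIV)"
    unfolding Tx[abs_def]
    by (rule sum_infsum_swap[symmetric])
      (auto intro!: finite_vsupp summable_on_cmult_left model_summable[OF f w])
  also have "\<dots> = (\<Sum>x\<in>vsupp. model f w x * cnj (e x))"
    unfolding Tx[abs_def] using w by (simp add: infsum_cmult_left' model_def)
  also have "\<dots> = l2_inner VV (model f w) e"
    using l2_inner_balanced(2)[OF e] by simp
  finally show ?thesis .
qed

section \<open>Sibling classes and evaluation of \<open>kappa\<close>\<close>

lemma sibF_props:
  assumes u: "u \<in> PhiF Vt rt F" and x: "x \<in> sibF Et F u"
  shows "x \<in> PhiF Vt rt F" "dp x = dp u" "u \<in> sibF Et F x"
proof -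
  \<comment> \<open>In a coordinate of \<open>F\<close> both vertices have the same parent, hence
    the same depth; elsewhere they agree. Equal depth lets the scalar at a representative serve its
    whole class.\<close>
  have *: "x j \<in> Vt j \<and> (x j \<noteq> rt j \<longleftrightarrow> j \<in> F) \<and> dp x j = dp u j \<and>
      (if j \<in> F then u j \<in> children (Et j) (parent (Et j) (x j)) else u j = x j)" for j
  proof (cases "j \<in> F")
    case True
    then have u': "u j \<in> Vt j" "u j \<noteq> rt j" and x': "x j \<in> children (Et j) (parent (Et j) (u j))"
      using u x by (auto simp: PhiF_def prodV_def sibF_def)
    then have xj: "x j \<in> Vt j" "x j \<noteq> rt j" "parent (Et j) (x j) = parent (Et j) (u j)"
      using leafless_tree.chi_iff[OF tree] by auto
    moreover have "dp x j = dp u j"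
      unfolding alpha_def using leafless_tree.depth_parent[OF tree u'] leafless_tree.depth_chi[OF tree x'] by simp
    moreover have "u j \<in> children (Et j) (parent (Et j) (u j))"
      using u' leafless_tree.chi_iff[OF tree] by auto
    ultimately show ?thesis using True by simp
  next
    case False
    then show ?thesis using u x by (auto simp: PhiF_def prodV_def sibF_def alpha_def)
  qed
  show "x \<in> PhiF Vt rt F" using * by (simp add: PhiF_def prodV_def)
  show "dp x = dp u" using * by auto
  show "u \<in> sibF Et F x" using * by (simp add: sibF_def)
qed

lemma finite_sibF:
  assumes "u \<in> PhiF Vt rt F"
  shows "finite (sibF Et F u)"
proof -
  have "sibF Et F u = {x. \<forall>j. x j \<in> (if j \<in> F then children (Et j) (parent (Et j) (u j)) else {u j})}"
    by (auto simp: sibF_def split: if_splits)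
  moreover have "finite (if j \<in> F then children (Et j) (parent (Et j) (u j)) else {u j})" for j
    using assms leafless_tree.finite_chi[OF tree leafless_tree.parent_in[OF tree]]
    by (auto simp: PhiF_def prodV_def)
  ultimately show ?thesis by (simp only: finite_dependent_functions)
qed

lemma sibF_subset:
  assumes "u \<in> PhiF Vt rt F"
  shows "sibF Et F u \<subseteq> VV"
proof
  fix x assume "x \<in> sibF Et F u"
  then have "x \<in> PhiF Vt rt F" using sibF_props(1) assms by blast
  then show "x \<in> VV" by (simp add: PhiF_def)
qed

text \<open>The cut-off of \<open>e\<close> belongs to \<open>LuF\<close>: the sibling sets in its
  conditions lie inside the class and carry constant weights, so the conditions become the sibling
  sums of \<open>e\<close>.\<close>

lemma orth_proj_LuF:
  assumes u: "u \<in> PhiF Vt rt F" and e: "e \<in> balanced"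
  shows "orth_proj VV (LuF Vt Et rt a F u) e = (\<lambda>x. if x \<in> sibF Et F u then e x else 0)"
proof (rule orth_proj_restriction[OF finite_sibF[OF u] sibF_subset[OF u]])
  show "m x = 0" if "m \<in> LuF Vt Et rt a F u" "x \<notin> sibF Et F u" for m x
    using that by (simp add: LuF_def)
  show "(\<lambda>x. m x - m' x) \<in> LuF Vt Et rt a F u"
    if "m \<in> LuF Vt Et rt a F u" "m' \<in> LuF Vt Et rt a F u" for m m'
  proof -
    have "(\<lambda>x. m x - m' x) \<in> l2 VV"
      by (rule l2_finite_support[OF finite_sibF[OF u] sibF_subset[OF u]]) (use that in \<open>simp add: LuF_def\<close>)
    then show ?thesis using that by (simp add: LuF_def left_diff_distrib sum_subtractf)
  qed
  show "(\<lambda>x. if x \<in> sibF Et F u then e x else 0) \<in> LuF Vt Et rt a F u"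
  proof -
    have "(\<lambda>x. if x \<in> sibF Et F u then e x else 0) \<in> l2 VV"
      by (rule l2_finite_support[OF finite_sibF[OF u] sibF_subset[OF u]]) simp
    moreover have "(\<Sum>w\<in>sib_j Et i v. (if w \<in> sibF Et F u then e w else 0) * complex_of_real (weight Et rt a i w)) = 0"
      if i: "i \<in> F" and v: "v \<in> sibF Et F u" for i v
    proof -
      have vP: "v \<in> VV" "v i \<noteq> rt i" using sibF_props(1)[OF u v] i by (auto simp: PhiF_def)
      define v' where "v' = par_j Et i v"
      have v': "v' \<in> VV" "v \<in> chij i v'" using par_j_in in_chij_par_j vP by (auto simp: v'_def)
      have sub: "w \<in> sibF Et F u" if "w \<in> chij i v'" for w
      proof -
        have "parent (Et i) (v i) = parent (Et i) (u i)"
        proof -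
          have "if i \<in> F then v i \<in> children (Et i) (parent (Et i) (u i)) else v i = u i"
            using v unfolding sibF_def by blast
          then show ?thesis using i leafless_tree.chi_iff[OF tree[of i]] by simp
        qed
        then show ?thesis using that v i by (auto simp: sibF_def chi_j_def v'_def par_j_def)
      qed
      have "(\<Sum>w\<in>chij i v'. (if w \<in> sibF Et F u then e w else 0) * complex_of_real (weight Et rt a i w))
          = (\<Sum>w\<in>chij i v'. e w * complex_of_real (weight Et rt a i v))"
        using sub weight_chij[OF v'(1)] v'(2) by (intro sum.cong) auto
      also have "\<dots> = 0"
        using e v' by (simp add: sum_distrib_right[symmetric] balanced_def)
      finally show ?thesis by (simp add: sib_j_def v'_def)
    qed
    ultimately show ?thesis by (simp add: LuF_def)
  qed
qed

lemma rt_in: "rt \<in> VV"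
  using leafless_tree.root_in[OF tree] by (simp add: prodV_def)

lemma orth_proj_root: "orth_proj VV (root_line rt) e = (\<lambda>x. if x \<in> {rt} then e x else 0)"
proof (rule orth_proj_restriction)
  show "(\<lambda>x. m x - m' x) \<in> root_line rt" if "m \<in> root_line rt" "m' \<in> root_line rt" for m m'
  proof -
    obtain c where "m = (\<lambda>x. if x = rt then c else 0)" using \<open>m \<in> _\<close> unfolding root_line_def by blast
    moreover obtain c' where "m' = (\<lambda>x. if x = rt then c' else 0)" using \<open>m' \<in> _\<close> unfolding root_line_def by blast
    ultimately have "(\<lambda>x. m x - m' x) = (\<lambda>x. if x = rt then c - c' else 0)" by auto
    then show ?thesis by (auto simp: root_line_def)
  qed
  show "(\<lambda>x. if x \<in> {rt} then e x else 0) \<in> root_line rt"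
    unfolding root_line_def by (intro CollectI exI[of _ "e rt"]) auto
qed (auto simp: root_line_def rt_in)

text \<open>A vertex \<open>x\<close> other than \<open>rt\<close> lies in the class of exactly one
  representative \<open>u\<close>, for \<open>F\<close> the set of coordinates where
  \<open>x\<close> is off the root. So one term of the double sum survives, and its scalar depends
  on \<open>dp u = dp x\<close>.\<close>

lemma kappa_eq:
  assumes Om: "\<forall>F. F \<noteq> {} \<longrightarrow> Om F \<subseteq> PhiF Vt rt F \<and>
               (\<forall>u\<in>PhiF Vt rt F. card (Om F \<inter> sibF Et F u) = 1)"
    and e: "e \<in> balanced"
  shows "kappa Vt Et rt a Om z w e x
    = infsum (\<lambda>\<alpha>. complex_of_real (ratio a (dp x) \<alpha>) * mpow z \<alpha> * cnj (mpow w \<alpha>)) UNIV * e x"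
proof -
  define K where "K m = infsum (\<lambda>\<alpha>. complex_of_real (ratio a m \<alpha>) * mpow z \<alpha> * cnj (mpow w \<alpha>)) UNIV" for m
  define Q where "Q F = infsum (\<lambda>u. K (dp u) * (if x \<in> sibF Et F u then e x else 0)) (Om F)" for F
  \<comment> \<open>The series on the root line is the case of depth 0 of the same scalar series
    \<open>K\<close>.\<close>
  have "kappa Vt Et rt a Om z w e x = K (\<lambda>_. 0) * (if x = rt then e x else 0)
      + (\<Sum>F\<in>{F. F \<noteq> {}}. infsum (\<lambda>u. K (dp u) * orth_proj VV (LuF Vt Et rt a F u) e x) (Om F))"
    unfolding kappa_def orth_proj_root K_def ratio_def
    by (simp add: mfact_def mabs_def)
  also have "(\<Sum>F\<in>{F. F \<noteq> {}}. infsum (\<lambda>u. K (dp u) * orth_proj VV (LuF Vt Et rt a F u) e x) (Om F))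
      = (\<Sum>F\<in>{F. F \<noteq> {}}. Q F)"
  proof (intro sum.cong refl)
    fix F :: "'d set" assume "F \<in> {F. F \<noteq> {}}"
    then have "Om F \<subseteq> PhiF Vt rt F" using Om by blast
    then show "infsum (\<lambda>u. K (dp u) * orth_proj VV (LuF Vt Et rt a F u) e x) (Om F) = Q F"
      unfolding Q_def by (intro infsum_cong) (auto simp: orth_proj_LuF[OF _ e])
  qed
  also have "K (\<lambda>_. 0) * (if x = rt then e x else 0) + (\<Sum>F\<in>{F. F \<noteq> {}}. Q F) = K (dp x) * e x"
  proof (cases "x \<in> VV")
    case False
    then have e0: "e x = 0" using e by (simp add: balanced_def)
    have "Q F = 0" for F by (simp add: Q_def e0 cong: if_cong)
    moreover have "(if x = rt then e x else 0) = 0" unfolding e0 by simp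
    ultimately show ?thesis by (simp only: e0 sum.neutral_const mult_zero_right add_0_right)
  next
    case x: True
    define F0 where "F0 = {j. x j \<noteq> rt j}"
    have xF0: "x \<in> PhiF Vt rt F0" using x by (simp add: PhiF_def F0_def)
    have Q0: "Q F = 0" if "F \<noteq> {}" "F \<noteq> F0" for F
    proof -
      have "x \<notin> sibF Et F u" if "u \<in> Om F" for u
      proof
        assume "x \<in> sibF Et F u"
        then have "x \<in> PhiF Vt rt F" using sibF_props(1) Om \<open>F \<noteq> {}\<close> that by blast
        then show False using \<open>F \<noteq> F0\<close> by (auto simp: PhiF_def F0_def)
      qed
      then have "Q F = infsum (\<lambda>_. 0) (Om F)"
        unfolding Q_def by (intro infsum_cong) auto
      then show ?thesis by simp
    qed
    show ?thesis
    proof (cases "x = rt")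
      case True
      then have "F0 = {}" by (simp add: F0_def)
      then have "(\<Sum>F\<in>{F. F \<noteq> {}}. Q F) = 0" using Q0 by (intro sum.neutral) auto
      moreover have "dp x = (\<lambda>_. 0)" using dp_0_iff[OF x] True by auto
      ultimately show ?thesis using True by simp
    next
      case False
      then have F0: "F0 \<noteq> {}" by (auto simp: F0_def fun_eq_iff)
      then have "card (Om F0 \<inter> sibF Et F0 x) = 1" using Om xF0 by blast
      then obtain u where u: "Om F0 \<inter> sibF Et F0 x = {u}" by (auto simp: card_1_singleton_iff)
      have iff: "x \<in> sibF Et F0 v \<longleftrightarrow> v = u" if "v \<in> Om F0" for v
        using sibF_props(3)[OF xF0, of v] sibF_props(3)[of v F0 x] u that Om F0 by blast
      have uO: "u \<in> Om F0" "dp u = dp x" using u sibF_props(2)[OF xF0, of u] by auto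
      have "Q F0 = infsum (\<lambda>v. K (dp v) * (if x \<in> sibF Et F0 v then e x else 0)) {u}"
        unfolding Q_def by (rule infsum_cong_neutral) (use iff uO in auto)
      also have "\<dots> = K (dp x) * e x" using iff uO by simp
      finally have "Q F0 = K (dp x) * e x" .
      moreover have "(\<Sum>F\<in>{F. F \<noteq> {}}. Q F) = (\<Sum>F\<in>{F0}. Q F)"
        by (rule sum.mono_neutral_right) (use F0 Q0 in auto)
      ultimately show ?thesis using False by simp
    qed
  qed
  finally show ?thesis by (simp add: K_def)
qed

end

theorem mainTheorem2:
  fixes Vt :: "'d::finite \<Rightarrow> 'a set" and Et :: "'d \<Rightarrow> ('a \<times> 'a) set" and rt :: "'d \<Rightarrow> 'a"
    and a :: real and Om :: "'d set \<Rightarrow> ('d \<Rightarrow> 'a) set"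
  assumes trees: "\<forall>j. rooted_tree (Vt j) (Et j) (rt j)"
    and lf: "\<forall>j. locally_finite (Vt j) (Et j)"
    and nl: "\<forall>j. leafless (Vt j) (Et j)"
    and fbi: "\<forall>j. finite_branching_index (Vt j) (Et j) (rt j)"
    and apos: "a > 0"
    and Om: "\<forall>F. F \<noteq> {} \<longrightarrow> Om F \<subseteq> PhiF Vt rt F \<and>
               (\<forall>u\<in>PhiF Vt rt F. card (Om F \<inter> sibF Et F u) = 1)"
  shows "\<exists>(H :: (complex ^ 'd \<Rightarrow> (('d \<Rightarrow> 'a) \<Rightarrow> complex)) set) ip U.
     U ` l2 (prodV Vt) = H \<and> inj_on U (l2 (prodV Vt)) \<and>
     (\<forall>f\<in>l2 (prodV Vt). \<forall>g\<in>l2 (prodV Vt).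
         U (\<lambda>x. f x + g x) = (\<lambda>z x. U f z x + U g z x) \<and>
         ip (U f) (U g) = l2_inner (prodV Vt) f g) \<and>
     (\<forall>c. \<forall>f\<in>l2 (prodV Vt). U (\<lambda>x. c * f x) = (\<lambda>z x. c * U f z x)) \<and>
     (\<forall>F\<in>H. holo_Evalued Vt (jointKer Vt Et rt a) F) \<and>
     (\<forall>j. \<forall>f\<in>l2 (prodV Vt). U (shift Vt Et rt a j f) = (\<lambda>z x. z $ j * U f z x)) \<and>
     (\<forall>w\<in>ball 0 1. \<forall>e\<in>jointKer Vt Et rt a.
        (\<lambda>z. if z \<in> ball 0 1 then kappa Vt Et rt a Om z w e else (\<lambda>_. 0)) \<in> H \<and>
        (\<forall>F\<in>H. ip F (\<lambda>z. if z \<in> ball 0 1 then kappa Vt Et rt a Om z w e else (\<lambda>_. 0))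
                 = l2_inner (prodV Vt) (F w) e))"
proof -
  interpret tree_product Vt Et rt a
    by (intro tree_product.intro leafless_tree.intro) (use trees lf nl fbi apos in auto)
  define L where "L = l2 (prodV Vt)"
  \<comment> \<open>Transported along \<open>model\<close>; injectivity makes this inner product
    agree with that of \<open>l2\<close>.\<close>
  define ip where "ip F G = l2_inner (prodV Vt) (inv_into L model F) (inv_into L model G)" for F G
  have inj: "inj_on model L"
    using model_injective by (auto simp: inj_on_def L_def)
  have ip: "ip (model f) (model g) = l2_inner (prodV Vt) f g" if "f \<in> L" "g \<in> L" for f g
    using inj that by (simp add: ip_def)
  have kernel: "(\<lambda>z. if z \<in> ball 0 1 then kappa Vt Et rt a Om z w e else (\<lambda>_. 0)) = model (synth (kernel_coef w e))"
    if "e \<in> balanced" for w e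
  proof (intro ext)
    fix z x
    show "(if z \<in> ball 0 1 then kappa Vt Et rt a Om z w e else (\<lambda>_. 0)) x = model (synth (kernel_coef w e)) z x"
    proof (cases "z \<in> ball 0 1")
      case True
      then show ?thesis
        by (simp only: kappa_eq[OF Om that] model_synth_kernel[OF that True] if_True)
    next
      case False
      then show ?thesis by (simp only: model_def if_False)
    qed
  qed
  show ?thesis
  proof (intro exI[of _ "model ` L"] exI[of _ ip] exI[of _ model], fold L_def, intro conjI ballI allI)
    show "model ` L = model ` L" ..
    show "inj_on model L" by (rule inj)
    fix f g assume "f \<in> L" "g \<in> L"
    then show "model (\<lambda>x. f x + g x) = (\<lambda>z x. model f z x + model g z x)"
      and "ip (model f) (model g) = l2_inner (prodV Vt) f g"
      using model_add ip by (simp_all add: L_def)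
  next
    fix c f assume "f \<in> L"
    show "model (\<lambda>x. c * f x) = (\<lambda>z x. c * model f z x)" by (rule model_cmult)
  next
    fix F assume "F \<in> model ` L"
    then show "holo_Evalued Vt (jointKer Vt Et rt a) F" using model_holo by (auto simp: L_def)
  next
    fix j f assume "f \<in> L"
    show "model (shift Vt Et rt a j f) = (\<lambda>z x. z $ j * model f z x)" by (rule model_shift)
  next
    fix w :: "complex ^ 'd" and e
    assume w: "w \<in> ball 0 1" and "e \<in> jointKer Vt Et rt a"
    then have e: "e \<in> balanced" using jointKer_eq by simp
    have g: "synth (kernel_coef w e) \<in> L" using synth_kernel_l2[OF e w] by (simp add: L_def)
    show "(\<lambda>z. if z \<in> ball 0 1 then kappa Vt Et rt a Om z w e else (\<lambda>_. 0)) \<in> model ` L"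
      unfolding kernel[OF e] using g by blast
    fix F assume "F \<in> model ` L"
    then obtain f where f: "f \<in> L" "F = model f" by blast
    show "ip F (\<lambda>z. if z \<in> ball 0 1 then kappa Vt Et rt a Om z w e else (\<lambda>_. 0)) = l2_inner (prodV Vt) (F w) e"
      unfolding kernel[OF e] f(2) ip[OF f(1) g] using reproducing[OF _ e w] f(1) by (simp add: L_def)
  qed
qed

end
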